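(* Let $N\geq 1$, let $G\in C^2(\mathbb{R})$ be a nonnegative function and let $u\in C^2(\mathbb{R}^N)$ be a stable, nonconstant, bounded solution of $\Delta u=G'(u)$ in $\mathbb{R}^N$. Suppose that there exists $K>0$ such that $-(\sqrt{G})''(s)\geq K$ for every $s\in u(\mathbb{R}^N)$. Then $$\lim_{R\to\infty}\frac{\displaystyle\int_{B_R}\frac{1}{2}|\nabla u|^2\,dx}{\displaystyle\int_{B_R}G(u)\,dx}=1.$$
   Context: A solution $u\in C^2(\mathbb{R}^N)$ of $\Delta u=G'(u)$ in $\mathbb{R}^N$ is called stable if $$Q(v):=\int_{\mathbb{R}^N}\left(|\nabla v|^2+G''(u)v^2\right)dx\geq 0$$ for every $v\in C^1(\mathbb{R}^N)$ with compact support in $\mathbb{R}^N$. For $R>0$, $B_R=\{x\in\mathbb{R}^N: |x|<R\}$. By a known theorem of Modica, if $G\in C^2(\mathbb{R})$ is nonnegative and $u$ is a bounded nonconstant solution of $\Delta u=G'(u)$ in $\mathbb{R}^N$, then $G(u(x))>0$ for all $x\in\mathbb{R}^N$. Hence $G>0$ on $u(\mathbb{R}^N)$ (and so on a neighborhood of it), and $(\sqrt{G})''$ is well defined on $u(\mathbb{R}^N)$. *)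

theory Defs
  imports "HOL-Analysis.Analysis"
begin

(* The Frechet derivative in direction b; it is the b-th partial derivative only where f is
   differentiable, which C1 and C2 require at every point. *)
definition partial_deriv :: "'a::euclidean_space \<Rightarrow> ('a \<Rightarrow> real) \<Rightarrow> 'a \<Rightarrow> real" where
  "partial_deriv b f x = frechet_derivative f (at x) b"

definition grad :: "('a::euclidean_space \<Rightarrow> real) \<Rightarrow> 'a \<Rightarrow> 'a" where
  "grad f x = (\<Sum>b\<in>Basis. partial_deriv b f x *\<^sub>R b)"

definition laplacian :: "('a::euclidean_space \<Rightarrow> real) \<Rightarrow> 'a \<Rightarrow> real" where
  "laplacian f x = (\<Sum>b\<in>Basis. partial_deriv b (partial_deriv b f) x)"

definition C1 :: "('a::euclidean_space \<Rightarrow> real) \<Rightarrow> bool" where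
  "C1 f \<longleftrightarrow> (\<forall>x. f differentiable (at x)) \<and>
    (\<forall>b\<in>Basis. continuous_on UNIV (partial_deriv b f))"

definition C2 :: "('a::euclidean_space \<Rightarrow> real) \<Rightarrow> bool" where
  "C2 f \<longleftrightarrow> C1 f \<and> (\<forall>b\<in>Basis. C1 (partial_deriv b f))"

definition compactly_supported :: "('a::topological_space \<Rightarrow> real) \<Rightarrow> bool" where
  "compactly_supported v \<longleftrightarrow> compact (closure {x. v x \<noteq> 0})"

definition is_solution :: "(real \<Rightarrow> real) \<Rightarrow> ('a::euclidean_space \<Rightarrow> real) \<Rightarrow> bool" where
  "is_solution G u \<longleftrightarrow> C2 u \<and> (\<forall>x. laplacian u x = deriv G (u x))"

definition second_variation ::
    "(real \<Rightarrow> real) \<Rightarrow> ('a::euclidean_space \<Rightarrow> real) \<Rightarrow> ('a \<Rightarrow> real) \<Rightarrow> real" where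
  "second_variation G u v =
    (LINT x|lborel. (norm (grad v x))\<^sup>2 + deriv (deriv G) (u x) * (v x)\<^sup>2)"

definition stable_solution :: "(real \<Rightarrow> real) \<Rightarrow> ('a::euclidean_space \<Rightarrow> real) \<Rightarrow> bool" where
  "stable_solution G u \<longleftrightarrow> is_solution G u \<and>
    (\<forall>v. C1 v \<and> compactly_supported v \<longrightarrow> second_variation G u v \<ge> 0)"

lemma GDERIV_grad:
  fixes f :: "'a::euclidean_space \<Rightarrow> real"
  assumes "f differentiable (at x)"
  shows "GDERIV f x :> grad f x"
proof -
  let ?D = "frechet_derivative f (at x)"
  have D: "(f has_derivative ?D) (at x)"
    using assms frechet_derivative_works by blast
  then have lin: "linear ?D"
    by (rule has_derivative_linear)
  have "?D h = inner h (grad f x)" for h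
  proof -
    have "?D h = ?D (\<Sum>b\<in>Basis. inner h b *\<^sub>R b)"
      by (simp add: euclidean_representation)
    also have "\<dots> = (\<Sum>b\<in>Basis. inner h b * ?D b)"
      by (simp add: linear_sum[OF lin] linear_scale[OF lin])
    also have "\<dots> = inner h (grad f x)"
      by (simp add: grad_def partial_deriv_def inner_sum_right mult.commute)
    finally show ?thesis .
  qed
  then have "?D = (\<lambda>h. inner h (grad f x))" by blast
  with D show ?thesis unfolding gderiv_def by simp
qed

lemma partial_deriv_real:
  fixes f :: "real \<Rightarrow> real"
  assumes "f differentiable (at x)"
  shows "partial_deriv 1 f x = deriv f x"
proof -
  have "f field_differentiable (at x)"
    using assms by (simp add: field_differentiable_def real_differentiable_def)
  then have "(f has_derivative (*) (deriv f x)) (at x)"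
    using DERIV_deriv_iff_field_differentiable has_field_derivative_def by blast
  then have "frechet_derivative f (at x) = (*) (deriv f x)"
    using frechet_derivative_at by metis
  then show ?thesis unfolding partial_deriv_def by simp
qed

lemma C2_real_iff:
  fixes f :: "real \<Rightarrow> real"
  shows "C2 f \<longleftrightarrow> (\<forall>x. f differentiable (at x)) \<and>
    (\<forall>x. deriv f differentiable (at x)) \<and> continuous_on UNIV (deriv (deriv f))"
proof (cases "\<forall>x. f differentiable (at x)")
  case True
  then have e1: "partial_deriv 1 f = deriv f"
    by (auto simp: partial_deriv_real)
  show ?thesis
  proof (cases "\<forall>x. deriv f differentiable (at x)")
    case diff: True
    then have e2: "partial_deriv 1 (deriv f) = deriv (deriv f)"
      by (auto simp: partial_deriv_real)
    have "continuous_on UNIV (deriv f)"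
      using diff by (simp add: continuous_at_imp_continuous_on differentiable_imp_continuous_within)
    with True diff e1 e2 show ?thesis by (simp add: C2_def C1_def)
  next
    case False
    with e1 show ?thesis by (auto simp: C2_def C1_def)
  qed
next
  case False
  then show ?thesis by (auto simp: C2_def C1_def)
qed

end

theory Submission
  imports Defs
begin

text \<open>
  Write \<open>g = \<nabla>u\<close> and \<open>P = 2 G(u) - |g|\<^sup>2\<close>.

  Modica's bound \<open>P \<ge> 0\<close> comes from the maximum principle for \<open>Q = |g|\<^sup>2 - 2 (G + \<epsilon> \<psi>)(u)\<close> with
  \<open>\<psi>(s) = e\<^sup>\<lambda>\<^sup>M - e\<^sup>-\<^sup>\<lambda>\<^sup>s\<close>: when \<open>\<lambda>\<close> is large depending on \<open>\<delta>\<close>, \<open>Q\<close> is a strict subsolution of an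
  elliptic equation with bounded drift wherever \<open>Q \<ge> \<delta>\<close>, so \<open>Q \<le> \<delta>\<close>; then \<open>\<epsilon>\<close> and \<open>\<delta>\<close> tend to zero.
  If \<open>G(u)\<close> vanished at a point, the bound would give \<open>|g| \<le> C |u - s\<^sub>0|\<close> and \<open>u\<close> would be constant.

  Stability tested with \<open>\<surd>G(u) \<phi>\<close>, together with the equation tested with \<open>G'(u) \<phi>\<^sup>2 / 2\<close>, gives
  \<open>K \<integral> \<surd>G(u) P \<phi>\<^sup>2 \<le> \<integral> G(u) |\<nabla>\<phi>|\<^sup>2\<close>, hence a bound of order \<open>R\<^sup>N\<^sup>-\<^sup>2\<close> for the integral of
  \<open>\<surd>G(u) P\<close> over \<open>B\<^sub>R\<close>.  As \<open>P \<le> 2 G(u)\<close>, we have \<open>P \<le> \<lambda> \<surd>G(u) P + 2 / \<lambda>\<^sup>2\<close> for all \<open>\<lambda> > 0\<close>, and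
  \<open>\<lambda> = R\<^sup>2\<^sup>/\<^sup>3\<close> bounds the integral of \<open>P\<close> by a multiple of \<open>R\<^sup>N\<^sup>-\<^sup>4\<^sup>/\<^sup>3\<close>.  By Pohozaev's identity the
  integral of \<open>G(u)\<close> is at least of order \<open>R\<^sup>N\<^sup>-\<^sup>1\<close>, so the quotient of the two tends to zero.
\<close>

section \<open>Twice continuously differentiable functions\<close>

lemma has_real_derivative_along_line:
  fixes f :: "'a::real_normed_vector \<Rightarrow> real"
  assumes "\<And>x. (f has_derivative f' x) (at x)"
  shows "((\<lambda>s. f (x + s *\<^sub>R k)) has_real_derivative f' (x + s *\<^sub>R k) k) (at s)"
proof -
  have "((\<lambda>s. x + s *\<^sub>R k) has_derivative (\<lambda>h. h *\<^sub>R k)) (at s)"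
    by (auto intro!: derivative_eq_intros)
  moreover have "linear (f' (x + s *\<^sub>R k))" using assms has_derivative_linear by blast
  ultimately show ?thesis
    unfolding has_field_derivative_def using has_derivative_compose[OF _ assms]
    by (fastforce simp: linear_scale mult.commute elim: has_derivative_eq_rhs)
qed

text \<open>The base point \<open>X n\<close> may move with the step: the mean value theorem turns
  the quotient into a derivative at an intermediate point, which still tends to \<open>x\<close>.
  This is needed at maximum points, whose position depends on the step size.\<close>

lemma tendsto_difference_quotient:
  fixes p :: "'a::euclidean_space \<Rightarrow> real"
  assumes der: "\<And>x. (p has_derivative (\<lambda>h. q x \<bullet> h)) (at x)"
    and cont: "continuous_on UNIV q"
    and T: "T \<longlonglongrightarrow> 0" "\<And>n. T n > (0::real)" and X: "X \<longlonglongrightarrow> x"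
  shows "(\<lambda>n. (p (X n + T n *\<^sub>R k) - p (X n)) / T n) \<longlonglongrightarrow> q x \<bullet> k"
proof -
  have "\<exists>s. 0 < s \<and> s < 1 \<and> (p (X n + T n *\<^sub>R k) - p (X n)) / T n = q (X n + (s * T n) *\<^sub>R k) \<bullet> k" for n
  proof -
    define f where "f = (\<lambda>s. p (X n + (s * T n) *\<^sub>R k))"
    have d: "(f has_real_derivative (T n * (q (X n + (s * T n) *\<^sub>R k) \<bullet> k))) (at s)" for s
      using has_real_derivative_along_line[OF der, of "X n" "T n *\<^sub>R k" s] by (simp add: f_def)
    obtain s where "0 < s" "s < 1" "f 1 - f 0 = (1 - 0) * (T n * (q (X n + (s * T n) *\<^sub>R k) \<bullet> k))"
      using MVT2[of 0 1 f "\<lambda>s. T n * (q (X n + (s * T n) *\<^sub>R k) \<bullet> k)"] d by auto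
    then show ?thesis using T(2)[of n]
      by (intro exI[of _ s]) (auto simp: f_def field_simps)
  qed
  then obtain s where s: "\<And>n. 0 < s n" "\<And>n. s n < (1::real)"
    and eq: "\<And>n. (p (X n + T n *\<^sub>R k) - p (X n)) / T n = q (X n + (s n * T n) *\<^sub>R k) \<bullet> k"
    by metis
  have "(\<lambda>n. s n * T n) \<longlonglongrightarrow> 0"
  proof (rule Lim_null_comparison[OF _ T(1)])
    show "\<forall>\<^sub>F n in sequentially. norm (s n * T n) \<le> T n"
      using s T(2) by (auto simp: abs_mult less_imp_le mult_le_cancel_right1)
  qed
  then have "(\<lambda>n. X n + (s n * T n) *\<^sub>R k) \<longlonglongrightarrow> x + 0 *\<^sub>R k"
    by (intro tendsto_intros X)
  then have "(\<lambda>n. q (X n + (s n * T n) *\<^sub>R k)) \<longlonglongrightarrow> q x"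
    using cont by (auto intro: continuous_on_tendsto_compose)
  then show ?thesis unfolding eq by (intro tendsto_intros)
qed

text \<open>If \<open>c\<close> were positive, \<open>f'\<close> would be positive just to the right
  of its zero at 0, and the mean value theorem would give a larger value of \<open>f\<close> there.
  Differentiability of \<open>f'\<close> at the single point 0 suffices.\<close>

lemma DERIV_local_max_second:
  fixes f f' :: "real \<Rightarrow> real"
  assumes "e > 0" and d: "\<And>s. (f has_real_derivative f' s) (at s)"
    and d2: "(f' has_real_derivative c) (at 0)"
    and max: "\<And>s. \<bar>s\<bar> < e \<Longrightarrow> f s \<le> f 0"
  shows "f' 0 = 0" "c \<le> 0"
proof -
  show 0: "f' 0 = 0"
    using DERIV_local_max[OF d, of e 0] max \<open>e > 0\<close> by auto
  show "c \<le> 0"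
  proof (rule ccontr)
    assume "\<not> c \<le> 0"
    then obtain r where r: "r > 0" "\<And>h. 0 < h \<Longrightarrow> h < r \<Longrightarrow> f' 0 < f' (0 + h)"
      using DERIV_pos_inc_right[OF d2] by auto
    define t where "t = min r e / 2"
    have t: "0 < t" "t < r" "t < e" using r(1) \<open>e > 0\<close> by (auto simp: t_def min_def)
    obtain z where "0 < z" "z < t" "f t - f 0 = (t - 0) * f' z"
      using MVT2[OF t(1), of f f'] d by auto
    with r(2)[of z] t 0 have "f t > f 0"
      by (metis add_0 diff_gt_0_iff_gt diff_zero mult_pos_pos order_less_trans)
    with max[of t] t show False by auto
  qed
qed

text \<open>The one-dimensional test is applied along each coordinate line through \<open>x\<close>;
  \<open>D b b\<close> is the pure second derivative in direction \<open>b\<close>.\<close>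

lemma local_max_gradient_Laplacian:
  fixes f :: "'a::euclidean_space \<Rightarrow> real"
  assumes "e > 0" and d: "\<And>x. (f has_derivative (\<lambda>h. g x \<bullet> h)) (at x)"
    and d2: "\<And>b. b \<in> Basis \<Longrightarrow> ((\<lambda>x. g x \<bullet> b) has_derivative D b) (at x)"
    and max: "\<And>y. dist x y < e \<Longrightarrow> f y \<le> f x"
  shows "g x = 0" "(\<Sum>b\<in>Basis. D b b) \<le> 0"
proof -
  have *: "g x \<bullet> b = 0 \<and> D b b \<le> 0" if b: "b \<in> Basis" for b
  proof -
    have 1: "((\<lambda>s. f (x + s *\<^sub>R b)) has_real_derivative (g (x + s *\<^sub>R b) \<bullet> b)) (at s)" for s
      by (rule has_real_derivative_along_line[OF d])
    have lin: "linear (D b)" using d2[OF b] has_derivative_linear by blast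
    have d2': "((\<lambda>x. g x \<bullet> b) has_derivative D b) (at (x + 0 *\<^sub>R b))" using d2[OF b] by simp
    have "((\<lambda>s. g (x + s *\<^sub>R b) \<bullet> b) has_derivative (\<lambda>s. D b (s *\<^sub>R b))) (at (0::real))"
    proof (rule has_derivative_compose[of "\<lambda>s. x + s *\<^sub>R b" "\<lambda>s. s *\<^sub>R b" 0 UNIV "\<lambda>x. g x \<bullet> b" "D b"])
      show "((\<lambda>s. x + s *\<^sub>R b) has_derivative (\<lambda>s. s *\<^sub>R b)) (at 0)"
        by (auto intro!: derivative_eq_intros)
    qed (rule d2')
    then have 2: "((\<lambda>s. g (x + s *\<^sub>R b) \<bullet> b) has_real_derivative D b b) (at 0)"
      unfolding has_field_derivative_def
      by (rule has_derivative_eq_rhs) (auto simp: fun_eq_iff linear_scale[OF lin])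
    have 3: "f (x + s *\<^sub>R b) \<le> f (x + 0 *\<^sub>R b)" if "\<bar>s\<bar> < e" for s
      using max[of "x + s *\<^sub>R b"] that b by (auto simp: dist_norm)
    show ?thesis
      using DERIV_local_max_second[OF \<open>e > 0\<close> 1 2 3] by auto
  qed
  show "g x = 0" by (rule euclidean_eqI) (simp add: *)
  show "(\<Sum>b\<in>Basis. D b b) \<le> 0" using * by (auto intro: sum_nonpos)
qed

text \<open>\<open>D x\<close> is the Hessian of \<open>u\<close> at \<open>x\<close> as a linear
  map, so the Laplacian is its trace, the sum of \<open>D x b \<bullet> b\<close> over the
  basis.\<close>

locale C2_function =
  fixes u :: "'a::euclidean_space \<Rightarrow> real" and g :: "'a \<Rightarrow> 'a" and D :: "'a \<Rightarrow> 'a \<Rightarrow> 'a"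
  assumes u_deriv: "(u has_derivative (\<lambda>h. g x \<bullet> h)) (at x)"
    and g_deriv: "(g has_derivative D x) (at x)"
    and D_cont: "continuous_on UNIV (\<lambda>x. D x k)"
begin

lemma linear_D: "linear (D x)"
  using g_deriv has_derivative_linear by blast

lemma g_cont: "continuous_on UNIV g"
  using g_deriv by (meson continuous_at_imp_continuous_on has_derivative_continuous)

lemma u_cont: "continuous_on UNIV u"
  using u_deriv by (meson continuous_at_imp_continuous_on has_derivative_continuous)

text \<open>The transpose of the Hessian applied to \<open>c\<close>. It gives each component of
  \<open>g\<close> a gradient vector before the symmetry of the Hessian is available.\<close>

lemma D_adjoint: "D x h \<bullet> c = (\<Sum>b\<in>Basis. (D x b \<bullet> c) *\<^sub>R b) \<bullet> h"
proof -
  have "D x h = D x (\<Sum>b\<in>Basis. (h \<bullet> b) *\<^sub>R b)"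
    by (simp add: euclidean_representation)
  also have "\<dots> = (\<Sum>b\<in>Basis. (h \<bullet> b) *\<^sub>R D x b)"
    by (simp only: linear_sum[OF linear_D] linear_scale[OF linear_D])
  finally have "D x h \<bullet> c = (\<Sum>b\<in>Basis. (h \<bullet> b) *\<^sub>R D x b) \<bullet> c" by simp
  also have "\<dots> = (\<Sum>b\<in>Basis. (D x b \<bullet> c) *\<^sub>R b) \<bullet> h"
    unfolding inner_sum_left by (rule sum.cong) (simp_all add: inner_commute)
  finally show ?thesis .
qed

lemma g_inner_deriv:
  "((\<lambda>x. g x \<bullet> c) has_derivative (\<lambda>h. (\<Sum>b\<in>Basis. (D x b \<bullet> c) *\<^sub>R b) \<bullet> h)) (at x)"
proof -
  have "((\<lambda>x. g x \<bullet> c) has_derivative (\<lambda>h. D x h \<bullet> c)) (at x)"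
    by (intro has_derivative_inner_left g_deriv)
  then show ?thesis by (simp only: D_adjoint[symmetric])
qed

lemma adjoint_cont: "continuous_on UNIV (\<lambda>x. \<Sum>b\<in>Basis. (D x b \<bullet> c) *\<^sub>R b)"
  by (intro continuous_intros D_cont)

lemma tendsto_g_difference_quotient:
  assumes "T \<longlonglongrightarrow> 0" "\<And>n. T n > (0::real)" "X \<longlonglongrightarrow> x"
  shows "(\<lambda>n. (1 / T n) *\<^sub>R (g (X n + T n *\<^sub>R k) - g (X n))) \<longlonglongrightarrow> D x k"
proof (rule tendsto_componentwise_iff[THEN iffD2], rule ballI)
  fix b :: 'a assume "b \<in> Basis"
  have "(\<lambda>n. (g (X n + T n *\<^sub>R k) \<bullet> b - g (X n) \<bullet> b) / T n)
      \<longlonglongrightarrow> (\<Sum>a\<in>Basis. (D x a \<bullet> b) *\<^sub>R a) \<bullet> k"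
    by (rule tendsto_difference_quotient[OF g_inner_deriv adjoint_cont assms])
  then show "(\<lambda>n. ((1 / T n) *\<^sub>R (g (X n + T n *\<^sub>R k) - g (X n))) \<bullet> b) \<longlonglongrightarrow> D x k \<bullet> b"
    unfolding D_adjoint[of x k b] by (simp add: inner_diff_left)
qed

text \<open>The mean value theorem in direction \<open>a\<close> reduces the second difference of
  \<open>u\<close> to a first difference of \<open>g \<bullet> a\<close> along \<open>b\<close> at a
  moving base point.\<close>

lemma tendsto_second_difference:
  assumes T: "T \<longlonglongrightarrow> 0" "\<And>n. T n > (0::real)"
  shows "(\<lambda>n. (u (x + T n *\<^sub>R a + T n *\<^sub>R b) - u (x + T n *\<^sub>R a) - u (x + T n *\<^sub>R b) + u x) / (T n)\<^sup>2)
    \<longlonglongrightarrow> D x b \<bullet> a"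
proof -
  have "\<exists>s. 0 < s \<and> s < 1 \<and>
      u (x + t *\<^sub>R a + t *\<^sub>R b) - u (x + t *\<^sub>R a) - u (x + t *\<^sub>R b) + u x
      = t * ((g (x + (s * t) *\<^sub>R a + t *\<^sub>R b) - g (x + (s * t) *\<^sub>R a)) \<bullet> a)" for t
  proof -
    define f where "f = (\<lambda>s. u (x + (s * t) *\<^sub>R a + t *\<^sub>R b) - u (x + (s * t) *\<^sub>R a))"
    define f' where "f' = (\<lambda>s. t * ((g (x + (s * t) *\<^sub>R a + t *\<^sub>R b) - g (x + (s * t) *\<^sub>R a)) \<bullet> a))"
    have d: "(f has_real_derivative f' s) (at s)" for s
      unfolding f_def f'_def
      using DERIV_diff[OF has_real_derivative_along_line[OF u_deriv, of "x + t *\<^sub>R b" "t *\<^sub>R a" s]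
        has_real_derivative_along_line[OF u_deriv, of x "t *\<^sub>R a" s]]
      by (simp add: algebra_simps)
    obtain s where "0 < s" "s < 1" "f 1 - f 0 = (1 - 0) * f' s"
      using MVT2[of 0 1 f f'] d by auto
    then show ?thesis
      by (intro exI[of _ s]) (auto simp: f_def f'_def)
  qed
  then have "\<forall>n. \<exists>s. 0 < s \<and> s < 1 \<and>
      u (x + T n *\<^sub>R a + T n *\<^sub>R b) - u (x + T n *\<^sub>R a) - u (x + T n *\<^sub>R b) + u x
      = T n * ((g (x + (s * T n) *\<^sub>R a + T n *\<^sub>R b) - g (x + (s * T n) *\<^sub>R a)) \<bullet> a)"
    by blast
  then obtain s where s: "\<And>n. 0 < s n" "\<And>n. s n < (1::real)" and eq: "\<And>n.
      u (x + T n *\<^sub>R a + T n *\<^sub>R b) - u (x + T n *\<^sub>R a) - u (x + T n *\<^sub>R b) + u x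
      = T n * ((g (x + (s n * T n) *\<^sub>R a + T n *\<^sub>R b) - g (x + (s n * T n) *\<^sub>R a)) \<bullet> a)"
    by metis
  have "(\<lambda>n. s n * T n) \<longlonglongrightarrow> 0"
  proof (rule Lim_null_comparison[OF _ T(1)])
    show "\<forall>\<^sub>F n in sequentially. norm (s n * T n) \<le> T n"
      using s T(2) by (auto simp: abs_mult less_imp_le mult_le_cancel_right1)
  qed
  then have "(\<lambda>n. x + (s n * T n) *\<^sub>R a) \<longlonglongrightarrow> x + 0 *\<^sub>R a"
    by (intro tendsto_intros)
  then have X: "(\<lambda>n. x + (s n * T n) *\<^sub>R a) \<longlonglongrightarrow> x" by simp
  have "(\<lambda>n. ((1 / T n) *\<^sub>R (g (x + (s n * T n) *\<^sub>R a + T n *\<^sub>R b) - g (x + (s n * T n) *\<^sub>R a))) \<bullet> a)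
      \<longlonglongrightarrow> D x b \<bullet> a"
    by (intro tendsto_intros tendsto_g_difference_quotient T X)
  then show ?thesis unfolding eq
    using T(2) by (simp add: power2_eq_square less_imp_neq[symmetric] inner_diff_left diff_divide_distrib)
qed

text \<open>Schwarz's theorem: the second difference is unchanged when \<open>a\<close> and
  \<open>b\<close> are exchanged, so its two limits agree.\<close>

lemma D_symmetric: "D x a \<bullet> b = D x b \<bullet> a"
proof -
  have T: "(\<lambda>n. 1 / real (Suc n)) \<longlonglongrightarrow> 0" by (rule LIMSEQ_Suc[OF lim_1_over_n])
  have 1: "(\<lambda>n. (u (x + (1 / real (Suc n)) *\<^sub>R a + (1 / real (Suc n)) *\<^sub>R b) - u (x + (1 / real (Suc n)) *\<^sub>R a)
    - u (x + (1 / real (Suc n)) *\<^sub>R b) + u x) / (1 / real (Suc n))\<^sup>2) \<longlonglongrightarrow> D x b \<bullet> a" for a b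
    by (rule tendsto_second_difference[OF T]) simp
  have eq: "(\<lambda>n. (u (x + (1 / real (Suc n)) *\<^sub>R a + (1 / real (Suc n)) *\<^sub>R b) - u (x + (1 / real (Suc n)) *\<^sub>R a)
    - u (x + (1 / real (Suc n)) *\<^sub>R b) + u x) / (1 / real (Suc n))\<^sup>2)
    = (\<lambda>n. (u (x + (1 / real (Suc n)) *\<^sub>R b + (1 / real (Suc n)) *\<^sub>R a) - u (x + (1 / real (Suc n)) *\<^sub>R b)
    - u (x + (1 / real (Suc n)) *\<^sub>R a) + u x) / (1 / real (Suc n))\<^sup>2)"
    by (auto simp: fun_eq_iff add_ac)
  show ?thesis
    using LIMSEQ_unique[OF 1[of a b, unfolded eq] 1[of b a]] by simp
qed

end

section \<open>Gradient and Hessian obtained from \<open>C1\<close> and \<open>C2\<close>\<close>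

lemma C1_D:
  assumes "C1 f"
  shows "(f has_derivative (\<lambda>h. grad f x \<bullet> h)) (at x)" "continuous_on UNIV (grad f)"
proof -
  show "(f has_derivative (\<lambda>h. grad f x \<bullet> h)) (at x)"
    using assms GDERIV_grad[of f x] by (auto simp: C1_def gderiv_def inner_commute)
  show "continuous_on UNIV (grad f)"
    unfolding grad_def using assms by (auto simp: C1_def intro!: continuous_intros)
qed

lemma partial_deriv_eq:
  assumes "(f has_derivative (\<lambda>h. g x \<bullet> h)) (at x)"
  shows "partial_deriv b f x = g x \<bullet> b"
  using assms by (metis frechet_derivative_at partial_deriv_def)

lemma C1_I:
  assumes "\<And>x. (f has_derivative (\<lambda>h. g x \<bullet> h)) (at x)" "continuous_on UNIV g"
  shows "C1 f" "grad f = g"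
proof -
  have p: "partial_deriv b f = (\<lambda>x. g x \<bullet> b)" for b
    by (rule ext) (rule partial_deriv_eq, rule assms)
  show "C1 f" unfolding C1_def p
    using assms by (auto simp: differentiable_def intro!: continuous_intros)
  show "grad f = g" unfolding grad_def p
    by (auto simp: euclidean_representation)
qed

lemma C2_imp_C2_function:
  fixes u :: "'a::euclidean_space \<Rightarrow> real"
  assumes "C2 u"
  defines "D \<equiv> \<lambda>x h. \<Sum>b\<in>Basis. (grad (partial_deriv b u) x \<bullet> h) *\<^sub>R b"
  shows "C2_function u (grad u) D" "laplacian u x = (\<Sum>b\<in>Basis. D x b \<bullet> b)"
proof -
  have u1: "C1 u" and p1: "\<And>b. b \<in> Basis \<Longrightarrow> C1 (partial_deriv b u)"
    using assms by (auto simp: C2_def)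
  show "C2_function u (grad u) D"
  proof
    show "(u has_derivative (\<lambda>h. grad u x \<bullet> h)) (at x)" for x by (rule C1_D[OF u1])
    show "(grad u has_derivative D x) (at x)" for x
      unfolding grad_def[of u] D_def
      by (intro has_derivative_sum has_derivative_scaleR_left C1_D p1)
    show "continuous_on UNIV (\<lambda>x. D x k)" for k
      unfolding D_def by (intro continuous_intros C1_D p1)
  qed
  show "laplacian u x = (\<Sum>b\<in>Basis. D x b \<bullet> b)"
    unfolding laplacian_def
  proof (rule sum.cong[OF refl])
    fix b :: 'a assume b: "b \<in> Basis"
    then have "partial_deriv b (partial_deriv b u) x = grad (partial_deriv b u) x \<bullet> b"
      by (intro partial_deriv_eq C1_D p1)
    also have "\<dots> = D x b \<bullet> b"
      using b by (simp add: D_def)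
    finally show "partial_deriv b (partial_deriv b u) x = D x b \<bullet> b" .
  qed
qed

section \<open>Global gradient bound\<close>

context C2_function
begin

text \<open>A barrier argument, in which \<open>u\<close> is compared with its reflection in the hyperplane through \<open>z\<close>
  orthogonal to a coordinate direction, on a half ball on one side of it.\<close>

lemma directional_gradient_bound:
  assumes k: "k \<in> Basis" and M: "\<And>x. \<bar>u x\<bar> \<le> M"
    and F: "\<And>x. \<bar>\<Sum>b\<in>Basis. D x b \<bullet> b\<bar> \<le> F"
  defines "L \<equiv> 2 * real DIM('a) * M + F + 1"
  shows "g z \<bullet> k \<le> L / 2"
proof -
  define r :: "'a \<Rightarrow> 'a" where "r = (\<lambda>y. y - (2 * (y \<bullet> k)) *\<^sub>R k)"
  have kk: "k \<bullet> k = 1" using k by simp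
  have M0: "0 \<le> M" using M[of z] by linarith
  have F0: "0 \<le> F" using F[of z] by linarith
  have L0: "0 \<le> L" using M0 F0 by (simp add: L_def)
  have r_adj: "a \<bullet> r b = r a \<bullet> b" for a b
    by (simp add: r_def inner_diff_left inner_diff_right inner_commute)
  have r_deriv: "(r has_derivative r) (at y)" for y
    unfolding r_def by (auto intro!: derivative_eq_intros)
  have zr_deriv: "((\<lambda>y. z + r y) has_derivative r) (at y)" for y
    using has_derivative_add[OF has_derivative_const r_deriv] by simp
  have z_deriv: "((\<lambda>y. z + y) has_derivative (\<lambda>h. h)) (at y)" for y
    by (auto intro!: derivative_eq_intros)
  \<comment> \<open>With t = \<open>y \<bullet> k\<close>, the barrier is 2 M |y|^2 + L (t - t^2).
    On the unit sphere its first term dominates the difference of the two values of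
    \<open>u\<close>, and t - t^2 is nonnegative there. The term - L t^2 makes the barrier strongly
    superharmonic.\<close>
  define w where "w = (\<lambda>y. u (z + y) - u (z + r y) - (2 * M * (y \<bullet> y) + L * (y \<bullet> k) - L * (y \<bullet> k)\<^sup>2))"
  define gw where "gw = (\<lambda>y. g (z + y) - r (g (z + r y)) - ((4 * M) *\<^sub>R y + L *\<^sub>R k - (2 * L * (y \<bullet> k)) *\<^sub>R k))"
  define Dw where "Dw = (\<lambda>y b h. D (z + y) h \<bullet> b - D (z + r y) (r h) \<bullet> r b - (4 * M * (h \<bullet> b) - 2 * L * (h \<bullet> k) * (k \<bullet> b)))"
  have w_deriv: "(w has_derivative (\<lambda>h. gw y \<bullet> h)) (at y)" for y
  proof -
    have 1: "((\<lambda>y. u (z + y)) has_derivative (\<lambda>h. g (z + y) \<bullet> h)) (at y)"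
      using has_derivative_compose[OF z_deriv u_deriv] .
    have 2: "((\<lambda>y. u (z + r y)) has_derivative (\<lambda>h. g (z + r y) \<bullet> r h)) (at y)"
      using has_derivative_compose[OF zr_deriv u_deriv] .
    have 3: "((\<lambda>y. 2 * M * (y \<bullet> y) + L * (y \<bullet> k) - L * (y \<bullet> k)\<^sup>2)
        has_derivative (\<lambda>h. ((4 * M) *\<^sub>R y + L *\<^sub>R k - (2 * L * (y \<bullet> k)) *\<^sub>R k) \<bullet> h)) (at y)"
      by (auto intro!: derivative_eq_intros simp: algebra_simps inner_commute)
    show ?thesis unfolding w_def
      by (rule has_derivative_eq_rhs[OF has_derivative_diff[OF has_derivative_diff[OF 1 2] 3]])
         (simp add: gw_def r_adj inner_diff_left)
  qed
  have gw_deriv: "((\<lambda>y. gw y \<bullet> b) has_derivative Dw y b) (at y)" for y b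
  proof -
    have 1: "((\<lambda>y. g (z + y) \<bullet> b) has_derivative (\<lambda>h. D (z + y) h \<bullet> b)) (at y)"
      using has_derivative_inner_left[OF has_derivative_compose[OF z_deriv g_deriv]] .
    have 2: "((\<lambda>y. g (z + r y) \<bullet> r b) has_derivative (\<lambda>h. D (z + r y) (r h) \<bullet> r b)) (at y)"
      using has_derivative_inner_left[OF has_derivative_compose[OF zr_deriv g_deriv]] .
    have 3: "((\<lambda>y. ((4 * M) *\<^sub>R y + L *\<^sub>R k - (2 * L * (y \<bullet> k)) *\<^sub>R k) \<bullet> b)
        has_derivative (\<lambda>h. 4 * M * (h \<bullet> b) - 2 * L * (h \<bullet> k) * (k \<bullet> b))) (at y)"
      by (auto intro!: derivative_eq_intros simp: algebra_simps)
    have eq: "(\<lambda>y. gw y \<bullet> b) = (\<lambda>y. g (z + y) \<bullet> b - g (z + r y) \<bullet> r b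
        - ((4 * M) *\<^sub>R y + L *\<^sub>R k - (2 * L * (y \<bullet> k)) *\<^sub>R k) \<bullet> b)"
      by (simp add: gw_def inner_diff_left r_adj)
    show ?thesis unfolding eq Dw_def
      by (rule has_derivative_diff[OF has_derivative_diff[OF 1 2] 3])
  qed
  \<comment> \<open>\<open>L\<close> was chosen for this: the reflection leaves the trace unchanged,
    so the Laplacian of \<open>w\<close> is at least - 2 F - 4 N M + 2 L = 2.\<close>
  have trace: "(\<Sum>b\<in>Basis. Dw y b b) \<ge> 2" for y
  proof -
    have rb: "r b = (if b = k then - b else b)" if "b \<in> Basis" for b
      using that k by (auto simp: r_def inner_Basis kk algebra_simps scaleR_2)
    have "(\<Sum>b\<in>Basis. D (z + r y) (r b) \<bullet> r b) = (\<Sum>b\<in>Basis. D (z + r y) b \<bullet> b)"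
      by (rule sum.cong) (auto simp: rb linear_neg[OF linear_D])
    moreover have "(\<Sum>b\<in>Basis. 4 * M * (b \<bullet> b) - 2 * L * (b \<bullet> k) * (k \<bullet> b)) = 4 * M * real DIM('a) - 2 * L"
    proof -
      have "(\<Sum>b\<in>Basis. 2 * L * (b \<bullet> k) * (k \<bullet> b)) = (\<Sum>b\<in>Basis. if b = k then 2 * L else 0)"
        by (rule sum.cong) (auto simp: inner_Basis k)
      then show ?thesis using k by (simp add: sum_subtractf)
    qed
    ultimately have "(\<Sum>b\<in>Basis. Dw y b b) = (\<Sum>b\<in>Basis. D (z + y) b \<bullet> b)
        - (\<Sum>b\<in>Basis. D (z + r y) b \<bullet> b) - (4 * M * real DIM('a) - 2 * L)"
      unfolding Dw_def sum_subtractf[of _ _ Basis] by simp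
    moreover have "(\<Sum>b\<in>Basis. D (z + y) b \<bullet> b) \<ge> - F" using F[of "z + y"] by linarith
    moreover have "(\<Sum>b\<in>Basis. D (z + r y) b \<bullet> b) \<le> F" using F[of "z + r y"] by linarith
    ultimately show ?thesis by (simp add: L_def)
  qed
  define A where "A = cball 0 1 \<inter> {y. 0 \<le> y \<bullet> k}"
  have "closed {y. 0 \<le> y \<bullet> k}"
    using closed_halfspace_ge[of 0 k] by (simp add: inner_commute)
  then have cA: "compact A" unfolding A_def by (intro compact_Int_closed) auto
  have "0 \<in> A" by (simp add: A_def)
  have w_cont: "continuous_on A w"
    using w_deriv by (meson continuous_at_imp_continuous_on has_derivative_continuous)
  obtain y where y: "y \<in> A" "\<And>x. x \<in> A \<Longrightarrow> w x \<le> w y"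
    using continuous_attains_sup[OF cA _ w_cont] \<open>0 \<in> A\<close> by auto
  have "w y \<le> 0"
  proof -
    \<comment> \<open>The maximum lies on the flat face, where \<open>r y = y\<close> and the two
      values of \<open>u\<close> cancel, on the sphere, or in the interior, where a Laplacian of at
      least 2 is impossible.\<close>
    consider "y \<bullet> k = 0" | "norm y = 1" "y \<bullet> k \<ge> 0" | "norm y < 1" "y \<bullet> k > 0"
      using y(1) by (fastforce simp: A_def)
    then show ?thesis
    proof cases
      case 1
      then show ?thesis using M0 by (simp add: w_def r_def)
    next
      case 2
      have "y \<bullet> k \<le> 1" using Cauchy_Schwarz_ineq2[of y k] 2 k by simp
      then have "L * (y \<bullet> k)\<^sup>2 \<le> L * (y \<bullet> k)"
        using 2 L0 by (intro mult_left_mono) (auto simp: power2_eq_square mult_left_le)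
      moreover have "y \<bullet> y = 1" using 2 by (simp add: dot_square_norm)
      ultimately show ?thesis using M[of "z + y"] M[of "z + r y"] by (simp add: w_def)
    next
      case 3
      have "y \<in> interior A"
      proof (rule interiorI)
        show "open (ball 0 1 \<inter> {y. 0 < y \<bullet> k})"
          using open_halfspace_gt[of 0 k] by (intro open_Int) (auto simp: inner_commute)
        show "y \<in> ball 0 1 \<inter> {y. 0 < y \<bullet> k}" using 3 by simp
        show "ball 0 1 \<inter> {y. 0 < y \<bullet> k} \<subseteq> A" by (auto simp: A_def)
      qed
      then obtain e where e: "e > 0" "ball y e \<subseteq> A" by (auto simp: mem_interior)
      then have "w x \<le> w y" if "dist y x < e" for x using that y(2) by auto
      from local_max_gradient_Laplacian(2)[OF e(1) w_deriv gw_deriv this] trace[of y] show ?thesis by simp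
    qed
  qed
  then have neg: "w (0 + s *\<^sub>R k) \<le> w 0" if "0 \<le> s" "s \<le> 1" for s
    using y(2)[of "s *\<^sub>R k"] that k by (auto simp: A_def w_def r_def)
  have d: "((\<lambda>s. w (0 + s *\<^sub>R k)) has_real_derivative gw (0 + 0 *\<^sub>R k) \<bullet> k) (at 0)"
    by (rule has_real_derivative_along_line[OF w_deriv])
  \<comment> \<open>\<open>w\<close> vanishes at 0 and is nonpositive on the segment along
    \<open>k\<close>, so its one-sided slope there is at most 0. The reflection doubles the
    derivative of \<open>u\<close> in this slope.\<close>
  have "gw 0 \<bullet> k \<le> 0"
  proof (rule ccontr)
    assume "\<not> gw 0 \<bullet> k \<le> 0"
    then obtain e where e: "e > 0" "\<And>h. 0 < h \<Longrightarrow> h < e \<Longrightarrow> w (0 + 0 *\<^sub>R k) < w (0 + (0 + h) *\<^sub>R k)"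
      using DERIV_pos_inc_right[OF d] by auto
    define h where "h = min 1 (e / 2)"
    have "0 < h" "h < e" "h \<le> 1" using e(1) by (auto simp: h_def min_def)
    with e(2)[of h] neg[of h] show False by simp
  qed
  moreover have "gw 0 \<bullet> k = 2 * (g z \<bullet> k) - L"
    by (simp add: gw_def r_def inner_diff_left inner_add_left kk)
  ultimately show ?thesis by simp
qed

lemma C2_function_minus: "C2_function (\<lambda>x. - u x) (\<lambda>x. - g x) (\<lambda>x h. - D x h)"
proof
  show "((\<lambda>x. - u x) has_derivative (\<lambda>h. - g x \<bullet> h)) (at x)" for x
    using has_derivative_minus[OF u_deriv] by simp
  show "((\<lambda>x. - g x) has_derivative (\<lambda>h. - D x h)) (at x)" for x
    by (rule has_derivative_minus[OF g_deriv])
  show "continuous_on UNIV (\<lambda>x. - D x k)" for k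
    by (intro continuous_intros D_cont)
qed

text \<open>The directional bound for \<open>u\<close> and for \<open>- u\<close> bounds every
  coordinate of the gradient on both sides.\<close>

lemma gradient_bounded:
  assumes M: "\<And>x. \<bar>u x\<bar> \<le> M" and F: "\<And>x. \<bar>\<Sum>b\<in>Basis. D x b \<bullet> b\<bar> \<le> F"
  shows "\<exists>C. \<forall>x. norm (g x) \<le> C"
proof -
  define L where "L = 2 * real DIM('a) * M + F + 1"
  have "\<bar>g x \<bullet> k\<bar> \<le> L / 2" if k: "k \<in> Basis" for x k
  proof -
    interpret m: C2_function "\<lambda>x. - u x" "\<lambda>x. - g x" "\<lambda>x h. - D x h"
      by (rule C2_function_minus)
    show ?thesis
      using directional_gradient_bound[OF k M F, of x] m.directional_gradient_bound[OF k, of M F x] M F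
      by (auto simp: L_def sum_negf)
  qed
  then have "norm (g x) \<le> (\<Sum>b\<in>(Basis::'a set). L / 2)" for x
    by (intro order_trans[OF norm_le_l1] sum_mono)
  then show ?thesis by blast
qed

end

section \<open>Modica's gradient bound\<close>

locale semilinear_solution = C2_function u g D
  for u :: "'a::euclidean_space \<Rightarrow> real" and g D +
  fixes G G1 G2 :: "real \<Rightarrow> real" and M :: real
  assumes G_deriv: "(G has_real_derivative G1 s) (at s)"
    and G1_deriv: "(G1 has_real_derivative G2 s) (at s)"
    and G2_cont: "continuous_on UNIV G2"
    and G_nonneg: "0 \<le> G s"
    and Laplace: "(\<Sum>b\<in>Basis. D x b \<bullet> b) = G1 (u x)"
    and u_bound: "\<bar>u x\<bar> \<le> M"
begin

lemma G1_cont: "continuous_on UNIV G1"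
  using G1_deriv by (meson DERIV_continuous continuous_at_imp_continuous_on)

lemma G_cont: "continuous_on UNIV G"
  using G_deriv by (meson DERIV_continuous continuous_at_imp_continuous_on)

lemma bounded_on_range:
  assumes "continuous_on UNIV (f :: real \<Rightarrow> real)"
  shows "\<exists>C>0. \<forall>x. \<bar>f (u x)\<bar> \<le> C"
proof -
  have "compact (f ` {-M..M})"
    by (intro compact_continuous_image continuous_on_subset[OF assms]) auto
  then obtain C where "C > 0" "\<forall>y\<in>f ` {-M..M}. norm y \<le> C"
    using compact_imp_bounded bounded_pos by metis
  moreover have "u x \<in> {-M..M}" for x using u_bound[of x] by auto
  ultimately show ?thesis by (intro exI[of _ C]) auto
qed

lemma tendsto_u: "X \<longlonglongrightarrow> x \<Longrightarrow> (\<lambda>n. u (X n)) \<longlonglongrightarrow> u x"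
  using u_cont by (auto intro: continuous_on_tendsto_compose)

lemma tendsto_g: "X \<longlonglongrightarrow> x \<Longrightarrow> (\<lambda>n. g (X n)) \<longlonglongrightarrow> g x"
  using g_cont by (auto intro: continuous_on_tendsto_compose)

lemma G1_u_deriv: "((\<lambda>x. G1 (u x)) has_derivative (\<lambda>h. (G2 (u x) *\<^sub>R g x) \<bullet> h)) (at x)"
  using has_derivative_compose[OF u_deriv G1_deriv[THEN has_field_derivative_imp_has_derivative]]
  by simp

lemma G2_u_cont: "continuous_on UNIV (\<lambda>x. G2 (u x))"
  using continuous_on_compose2[OF G2_cont u_cont] by auto

text \<open>As \<open>u\<close> is only \<open>C\<^sup>2\<close>, \<open>Q = |g|\<^sup>2 - 2 H(u)\<close> has no classical Laplacian.  It is replaced by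
  difference quotients of \<open>u\<close>, for which the maximum principle applies, and the step size tends to
  zero at the maximum points.\<close>

lemma approximate_max_point:
  fixes H H1 H2 :: "real \<Rightarrow> real"
  assumes H: "\<And>s. (H has_real_derivative H1 s) (at s)"
    and H1: "\<And>s. (H1 has_real_derivative H2 s) (at s)"
    and H2_cont: "continuous_on UNIV H2"
    and \<mu>: "\<mu> > 0"
  defines "Q \<equiv> \<lambda>x. (norm (g x))\<^sup>2 - 2 * H (u x)"
  assumes near: "\<And>y. Q y - 2 * \<mu> < Q x1"
  shows "\<exists>x. dist x1 x < 1 \<and> Q x \<ge> Q x1 \<and>
     (\<Sum>k\<in>Basis. (2 * (g x \<bullet> k)) *\<^sub>R D x k) - (2 * H1 (u x)) *\<^sub>R g x = (4 * \<mu>) *\<^sub>R (x - x1) \<and>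
     (\<Sum>k\<in>Basis. (norm (D x k))\<^sup>2) + (G2 (u x) - H2 (u x)) * (norm (g x))\<^sup>2
       - H1 (u x) * G1 (u x) \<le> 2 * \<mu> * real DIM('a)"
proof -
  have H_cont: "continuous_on UNIV H"
    using H by (meson DERIV_continuous continuous_at_imp_continuous_on)
  have H1_cont: "continuous_on UNIV H1"
    using H1 by (meson DERIV_continuous continuous_at_imp_continuous_on)
  have Hu_deriv: "((\<lambda>x. H (u x)) has_derivative (\<lambda>h. (H1 (u x) *\<^sub>R g x) \<bullet> h)) (at x)" for x
    using has_derivative_compose[OF u_deriv H[THEN has_field_derivative_imp_has_derivative]] by simp
  have H1u_deriv: "((\<lambda>x. H1 (u x)) has_derivative (\<lambda>h. (H2 (u x) *\<^sub>R g x) \<bullet> h)) (at x)" for x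
    using has_derivative_compose[OF u_deriv H1[THEN has_field_derivative_imp_has_derivative]] by simp
  define d where "d = (\<lambda>t k x. (u (x + t *\<^sub>R k) - u x) / t)"
  define e where "e = (\<lambda>t k x. (1 / t) *\<^sub>R (g (x + t *\<^sub>R k) - g x))"
  define De where "De = (\<lambda>t k x h. (1 / t) *\<^sub>R (D (x + t *\<^sub>R k) h - D x h))"
  have shift: "((\<lambda>x. x + c) has_derivative (\<lambda>h. h)) (at x)" for x c :: 'a
    by (auto intro!: derivative_eq_intros)
  have d_deriv: "(d t k has_derivative (\<lambda>h. e t k x \<bullet> h)) (at x)" for t k x
  proof -
    have "((\<lambda>x. (u (x + t *\<^sub>R k) - u x) / t) has_derivative (\<lambda>h. (g (x + t *\<^sub>R k) \<bullet> h - g x \<bullet> h) / t)) (at x)"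
      by (intro bounded_linear.has_derivative[OF bounded_linear_divide]
        has_derivative_diff u_deriv has_derivative_compose[OF shift u_deriv])
    then show ?thesis unfolding d_def e_def
      by (rule has_derivative_eq_rhs) (auto simp: inner_diff_left)
  qed
  have e_deriv: "(e t k has_derivative De t k x) (at x)" for t k x
    unfolding e_def De_def
    by (intro has_derivative_scaleR_right has_derivative_diff g_deriv has_derivative_compose[OF shift g_deriv])
  \<comment> \<open>The components of \<open>g\<close> in \<open>Q\<close> are replaced by
    difference quotients of \<open>u\<close>, which are twice differentiable. The penalty has size
    \<open>2 * \<mu>\<close> on the unit sphere around \<open>x1\<close> and keeps the maximum off
    it.\<close>
  define Qt where "Qt = (\<lambda>t x. (\<Sum>k\<in>Basis. (d t k x)\<^sup>2) - 2 * H (u x) - 2 * \<mu> * ((x - x1) \<bullet> (x - x1)))"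
  define gQt where "gQt = (\<lambda>t x. (\<Sum>k\<in>Basis. (2 * d t k x) *\<^sub>R e t k x) - (2 * H1 (u x)) *\<^sub>R g x
      - (4 * \<mu>) *\<^sub>R (x - x1))"
  define DQt where "DQt = (\<lambda>t x b h. (\<Sum>k\<in>Basis. 2 * (e t k x \<bullet> h) * (e t k x \<bullet> b) + 2 * d t k x * (De t k x h \<bullet> b))
      - (2 * H2 (u x) * (g x \<bullet> h) * (g x \<bullet> b) + 2 * H1 (u x) * (D x h \<bullet> b)) - 4 * \<mu> * (h \<bullet> b))"
  have Qt_deriv: "(Qt t has_derivative (\<lambda>h. gQt t x \<bullet> h)) (at x)" for t x
  proof -
    have "((\<lambda>x. (d t k x)\<^sup>2) has_derivative (\<lambda>h. 2 * d t k x * (e t k x \<bullet> h))) (at x)" for k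
      using has_derivative_power[OF d_deriv, where n = 2] by (simp add: mult_ac)
    then have 1: "((\<lambda>x. \<Sum>k\<in>Basis. (d t k x)\<^sup>2) has_derivative (\<lambda>h. \<Sum>k\<in>Basis. 2 * d t k x * (e t k x \<bullet> h))) (at x)"
      by (intro has_derivative_sum)
    have 2: "((\<lambda>x. 2 * H (u x)) has_derivative (\<lambda>h. 2 * ((H1 (u x) *\<^sub>R g x) \<bullet> h))) (at x)"
      by (rule has_derivative_mult_right[OF Hu_deriv])
    have 3: "((\<lambda>x. 2 * \<mu> * ((x - x1) \<bullet> (x - x1))) has_derivative (\<lambda>h. 4 * \<mu> * ((x - x1) \<bullet> h))) (at x)"
      by (auto intro!: derivative_eq_intros simp: inner_commute)
    show ?thesis unfolding Qt_def
      by (rule has_derivative_eq_rhs[OF has_derivative_diff[OF has_derivative_diff[OF 1 2] 3]])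
         (simp add: gQt_def inner_diff_left inner_sum_left mult.assoc)
  qed
  have gQt_deriv: "((\<lambda>x. gQt t x \<bullet> b) has_derivative DQt t x b) (at x)" for t x b
  proof -
    have "((\<lambda>x. 2 * d t k x * (e t k x \<bullet> b)) has_derivative
        (\<lambda>h. 2 * (e t k x \<bullet> h) * (e t k x \<bullet> b) + 2 * d t k x * (De t k x h \<bullet> b))) (at x)" for k
      by (rule has_derivative_eq_rhs[OF has_derivative_mult[OF has_derivative_mult_right[OF d_deriv]
        has_derivative_inner_left[OF e_deriv]]]) (auto simp: fun_eq_iff)
    then have 1: "((\<lambda>x. \<Sum>k\<in>Basis. 2 * d t k x * (e t k x \<bullet> b)) has_derivative
        (\<lambda>h. \<Sum>k\<in>Basis. 2 * (e t k x \<bullet> h) * (e t k x \<bullet> b) + 2 * d t k x * (De t k x h \<bullet> b))) (at x)"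
      by (intro has_derivative_sum)
    have 2: "((\<lambda>x. 2 * H1 (u x) * (g x \<bullet> b)) has_derivative
        (\<lambda>h. 2 * H2 (u x) * (g x \<bullet> h) * (g x \<bullet> b) + 2 * H1 (u x) * (D x h \<bullet> b))) (at x)"
      by (rule has_derivative_eq_rhs[OF has_derivative_mult[OF has_derivative_mult_right[OF H1u_deriv]
        has_derivative_inner_left[OF g_deriv]]]) (auto simp: fun_eq_iff)
    have 3: "((\<lambda>x. 4 * \<mu> * ((x - x1) \<bullet> b)) has_derivative (\<lambda>h. 4 * \<mu> * (h \<bullet> b))) (at x)"
      by (auto intro!: derivative_eq_intros)
    have eq: "(\<lambda>x. gQt t x \<bullet> b) = (\<lambda>x. (\<Sum>k\<in>Basis. 2 * d t k x * (e t k x \<bullet> b)) - 2 * H1 (u x) * (g x \<bullet> b)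
        - 4 * \<mu> * ((x - x1) \<bullet> b))"
      by (simp add: gQt_def inner_diff_left inner_sum_left)
    show ?thesis unfolding eq DQt_def
      by (rule has_derivative_diff[OF has_derivative_diff[OF 1 2] 3])
  qed
  have norm2: "(norm v)\<^sup>2 = (\<Sum>b\<in>Basis. (v \<bullet> b) * (v \<bullet> b))" for v :: 'a
    by (simp only: power2_norm_eq_inner euclidean_inner[of v v])
  \<comment> \<open>The Laplacian of a difference quotient of \<open>u\<close> is, by the equation,
    a difference quotient of \<open>G1 (u x)\<close>. This takes the place of third derivatives of
    \<open>u\<close>.\<close>
  have trace: "(\<Sum>b\<in>Basis. DQt t x b b) = (\<Sum>k\<in>Basis. 2 * (norm (e t k x))\<^sup>2
      + 2 * d t k x * ((G1 (u (x + t *\<^sub>R k)) - G1 (u x)) / t))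
      - (2 * H2 (u x) * (norm (g x))\<^sup>2 + 2 * H1 (u x) * G1 (u x)) - 4 * \<mu> * real DIM('a)" for t x
  proof -
    have "(\<Sum>b\<in>Basis. De t k x b \<bullet> b) = (G1 (u (x + t *\<^sub>R k)) - G1 (u x)) / t" for k
      unfolding Laplace[symmetric] De_def inner_scaleR_left sum_distrib_left[symmetric]
      by (simp add: inner_diff_left sum_subtractf)
    then have "(\<Sum>b\<in>Basis. 2 * (e t k x \<bullet> b) * (e t k x \<bullet> b) + 2 * d t k x * (De t k x b \<bullet> b))
       = 2 * (norm (e t k x))\<^sup>2 + 2 * d t k x * ((G1 (u (x + t *\<^sub>R k)) - G1 (u x)) / t)" for k
      unfolding sum.distrib mult.assoc sum_distrib_left[symmetric] norm2 by simp
    then have 1: "(\<Sum>b\<in>Basis. \<Sum>k\<in>Basis. 2 * (e t k x \<bullet> b) * (e t k x \<bullet> b) + 2 * d t k x * (De t k x b \<bullet> b))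
        = (\<Sum>k\<in>Basis. 2 * (norm (e t k x))\<^sup>2 + 2 * d t k x * ((G1 (u (x + t *\<^sub>R k)) - G1 (u x)) / t))"
      by (subst sum.swap) simp
    have 2: "(\<Sum>b\<in>Basis. 2 * H2 (u x) * (g x \<bullet> b) * (g x \<bullet> b) + 2 * H1 (u x) * (D x b \<bullet> b))
        = 2 * H2 (u x) * (norm (g x))\<^sup>2 + 2 * H1 (u x) * G1 (u x)"
      unfolding sum.distrib mult.assoc sum_distrib_left[symmetric] norm2 Laplace by simp
    have 3: "(\<Sum>b\<in>(Basis::'a set). 4 * \<mu> * (b \<bullet> b)) = 4 * \<mu> * real DIM('a)" by simp
    show ?thesis unfolding DQt_def sum_subtractf 1 2 3 ..
  qed
  define T where "T = (\<lambda>n. 1 / real (Suc n))"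
  have T: "T \<longlonglongrightarrow> 0" "\<And>n. T n > 0" unfolding T_def by (rule LIMSEQ_Suc[OF lim_1_over_n]) simp
  \<comment> \<open>For each step size a maximum point on the closed unit ball is chosen, and a
    subsequence of these points converges.\<close>
  have "\<exists>x\<in>cball x1 1. \<forall>y\<in>cball x1 1. Qt (T n) y \<le> Qt (T n) x" for n
    using Qt_deriv by (intro continuous_attains_sup)
      (auto intro!: continuous_at_imp_continuous_on has_derivative_continuous)
  then obtain X where X: "\<And>n. X n \<in> cball x1 1" "\<And>n y. y \<in> cball x1 1 \<Longrightarrow> Qt (T n) y \<le> Qt (T n) (X n)"
    by metis
  obtain x r where x: "x \<in> cball x1 1" and r: "strict_mono r" and lim: "(X \<circ> r) \<longlonglongrightarrow> x"
    using compact_cball[of x1 1] X(1) unfolding compact_def by blast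
  define Y where "Y = (\<lambda>n. X (r n))"
  define S where "S = (\<lambda>n. T (r n))"
  have Y: "Y \<longlonglongrightarrow> x" using lim by (simp add: Y_def o_def)
  have S: "S \<longlonglongrightarrow> 0" "\<And>n. S n > 0"
    using LIMSEQ_subseq_LIMSEQ[OF T(1) r] T(2) by (auto simp: S_def o_def)
  have d_lim: "(\<lambda>n. d (S n) k (Z n)) \<longlonglongrightarrow> g z \<bullet> k" if "Z \<longlonglongrightarrow> z" for k Z z
    unfolding d_def by (rule tendsto_difference_quotient[OF u_deriv g_cont S that])
  have e_lim: "(\<lambda>n. e (S n) k (Y n)) \<longlonglongrightarrow> D x k" for k
    unfolding e_def by (rule tendsto_g_difference_quotient[OF S Y])
  have G1_lim: "(\<lambda>n. (G1 (u (Y n + S n *\<^sub>R k)) - G1 (u (Y n))) / S n) \<longlonglongrightarrow> (G2 (u x) *\<^sub>R g x) \<bullet> k" for k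
    by (rule tendsto_difference_quotient[OF G1_u_deriv _ S Y]) (intro continuous_intros G2_u_cont g_cont)
  have Hs: "(\<lambda>n. H (u (Z n))) \<longlonglongrightarrow> H (u z)" if "Z \<longlonglongrightarrow> z" for Z z
    using tendsto_u[OF that] H_cont by (auto intro: continuous_on_tendsto_compose)
  have H1s: "(\<lambda>n. H1 (u (Y n))) \<longlonglongrightarrow> H1 (u x)"
    using tendsto_u[OF Y] H1_cont by (auto intro: continuous_on_tendsto_compose)
  have H2s: "(\<lambda>n. H2 (u (Y n))) \<longlonglongrightarrow> H2 (u x)"
    using tendsto_u[OF Y] H2_cont by (auto intro: continuous_on_tendsto_compose)
  have G1s: "(\<lambda>n. G1 (u (Y n))) \<longlonglongrightarrow> G1 (u x)"
    using tendsto_u[OF Y] G1_cont by (auto intro: continuous_on_tendsto_compose)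
  have Qt_lim: "(\<lambda>n. Qt (S n) (Z n)) \<longlonglongrightarrow> Q z - 2 * \<mu> * ((z - x1) \<bullet> (z - x1))" if "Z \<longlonglongrightarrow> z" for Z z
    unfolding Qt_def Q_def norm2
    unfolding power2_eq_square by (intro tendsto_intros d_lim Hs that)
  \<comment> \<open>The limit of the comparison between the maximum and the value at the centre,
    where the penalty vanishes.\<close>
  have "Q x1 \<le> Q x - 2 * \<mu> * ((x - x1) \<bullet> (x - x1))"
  proof (rule LIMSEQ_le[OF _ Qt_lim[OF Y]])
    show "(\<lambda>n. Qt (S n) x1) \<longlonglongrightarrow> Q x1" using Qt_lim[OF tendsto_const, of x1] by simp
    show "\<exists>N. \<forall>n\<ge>N. Qt (S n) x1 \<le> Qt (S n) (Y n)" using X(2)[of x1] by (auto simp: S_def Y_def)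
  qed
  then have Qx: "Q x1 \<le> Q x - 2 * \<mu> * (dist x1 x)\<^sup>2"
    using power2_norm_eq_inner[of "x - x1"] by (simp only: dist_norm norm_minus_commute[of x1 x])
  \<comment> \<open>At distance 1 the penalty would cost exactly the \<open>2 * \<mu>\<close> that
    separates \<open>Q x1\<close> from every value of \<open>Q\<close>.\<close>
  have less1: "dist x1 x < 1"
  proof (rule ccontr)
    assume "\<not> dist x1 x < 1"
    then have "dist x1 x = 1" using x by simp
    with Qx near[of x] show False by simp
  qed
  have "(\<lambda>n. dist x1 (Y n)) \<longlonglongrightarrow> dist x1 x" by (intro tendsto_intros Y)
  then have ev: "\<forall>\<^sub>F n in sequentially. dist x1 (Y n) < 1" using less1 by (rule order_tendstoD)
  \<comment> \<open>Eventually the maximum points lie in the open ball, so the first and second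
    order conditions hold at them and pass to the limit.\<close>
  have crit: "gQt (S n) (Y n) = 0 \<and> (\<Sum>b\<in>Basis. DQt (S n) (Y n) b b) \<le> 0" if "dist x1 (Y n) < 1" for n
  proof -
    have "Qt (S n) y \<le> Qt (S n) (Y n)" if y: "dist (Y n) y < 1 - dist x1 (Y n)" for y
      using X(2)[of y "r n"] y dist_triangle[of x1 y "Y n"] by (simp add: S_def Y_def)
    moreover have "0 < 1 - dist x1 (Y n)" using that by simp
    ultimately show ?thesis using local_max_gradient_Laplacian[OF _ Qt_deriv gQt_deriv] by blast
  qed
  have "(\<lambda>n. gQt (S n) (Y n)) \<longlonglongrightarrow> (\<Sum>k\<in>Basis. (2 * (g x \<bullet> k)) *\<^sub>R D x k) - (2 * H1 (u x)) *\<^sub>R g x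
      - (4 * \<mu>) *\<^sub>R (x - x1)"
    unfolding gQt_def by (intro tendsto_intros d_lim[OF Y] e_lim H1s tendsto_g Y)
  moreover have "(\<lambda>n. gQt (S n) (Y n)) \<longlonglongrightarrow> 0"
    by (rule tendsto_eventually, rule eventually_mono[OF ev]) (use crit in blast)
  ultimately have grad0: "(\<Sum>k\<in>Basis. (2 * (g x \<bullet> k)) *\<^sub>R D x k) - (2 * H1 (u x)) *\<^sub>R g x = (4 * \<mu>) *\<^sub>R (x - x1)"
    by (metis LIMSEQ_unique right_minus_eq)
  have "(\<lambda>n. \<Sum>b\<in>Basis. DQt (S n) (Y n) b b) \<longlonglongrightarrow> (\<Sum>k\<in>Basis. 2 * (norm (D x k))\<^sup>2
      + 2 * (g x \<bullet> k) * ((G2 (u x) *\<^sub>R g x) \<bullet> k))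
      - (2 * H2 (u x) * (norm (g x))\<^sup>2 + 2 * H1 (u x) * G1 (u x)) - 4 * \<mu> * real DIM('a)"
    unfolding trace by (intro tendsto_intros d_lim[OF Y] e_lim G1_lim H1s H2s G1s tendsto_g Y)
  moreover have "(\<Sum>k\<in>Basis. 2 * (norm (D x k))\<^sup>2 + 2 * (g x \<bullet> k) * ((G2 (u x) *\<^sub>R g x) \<bullet> k))
      = 2 * (\<Sum>k\<in>Basis. (norm (D x k))\<^sup>2) + 2 * G2 (u x) * (norm (g x))\<^sup>2"
    unfolding norm2[of "g x"] by (simp add: sum.distrib sum_distrib_left mult_ac)
  ultimately have "(\<lambda>n. \<Sum>b\<in>Basis. DQt (S n) (Y n) b b) \<longlonglongrightarrow>
      2 * (\<Sum>k\<in>Basis. (norm (D x k))\<^sup>2) + 2 * G2 (u x) * (norm (g x))\<^sup>2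
      - (2 * H2 (u x) * (norm (g x))\<^sup>2 + 2 * H1 (u x) * G1 (u x)) - 4 * \<mu> * real DIM('a)" by simp
  then have le0: "2 * (\<Sum>k\<in>Basis. (norm (D x k))\<^sup>2) + 2 * G2 (u x) * (norm (g x))\<^sup>2
      - (2 * H2 (u x) * (norm (g x))\<^sup>2 + 2 * H1 (u x) * G1 (u x)) - 4 * \<mu> * real DIM('a) \<le> 0"
    by (rule tendsto_upperbound) (use eventually_mono[OF ev crit] in \<open>auto simp: eventually_conj_iff\<close>)
  have "0 \<le> \<mu> * (dist x1 x)\<^sup>2" using \<mu> by simp
  then have "Q x \<ge> Q x1" using Qx by linarith
  moreover have "(\<Sum>k\<in>Basis. (norm (D x k))\<^sup>2) + (G2 (u x) - H2 (u x)) * (norm (g x))\<^sup>2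
       - H1 (u x) * G1 (u x) \<le> 2 * \<mu> * real DIM('a)"
    using le0 by (simp add: left_diff_distrib)
  ultimately show ?thesis using grad0 less1 by blast
qed

end

lemma norm_sum_scaleR_squared_le:
  fixes W :: "'b \<Rightarrow> 'a::real_normed_vector"
  shows "(norm (\<Sum>k\<in>A. a k *\<^sub>R W k))\<^sup>2 \<le> (\<Sum>k\<in>A. (a k)\<^sup>2) * (\<Sum>k\<in>A. (norm (W k))\<^sup>2)"
proof -
  have "norm (\<Sum>k\<in>A. a k *\<^sub>R W k) \<le> (\<Sum>k\<in>A. \<bar>a k\<bar> * norm (W k))"
    using norm_sum[of "\<lambda>k. a k *\<^sub>R W k" A] by simp
  then have "(norm (\<Sum>k\<in>A. a k *\<^sub>R W k))\<^sup>2 \<le> (\<Sum>k\<in>A. \<bar>a k\<bar> * norm (W k))\<^sup>2"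
    by (intro power_mono) auto
  also have "\<dots> \<le> (\<Sum>k\<in>A. \<bar>a k\<bar>\<^sup>2) * (\<Sum>k\<in>A. (norm (W k))\<^sup>2)"
    by (rule Cauchy_Schwarz_ineq_sum)
  finally show ?thesis by simp
qed

context semilinear_solution
begin

text \<open>Where \<open>|g|\<^sup>2 - 2 H(u)\<close> nearly attains its supremum, its gradient \<open>v\<close> is small, and
  Cauchy-Schwarz applied to \<open>v / 2 + H'(u) g = D\<^sup>2u \<cdot> g\<close> bounds the Hessian from below.\<close>

lemma hessian_lower_bound:
  assumes v: "(\<Sum>k\<in>Basis. (2 * (g x \<bullet> k)) *\<^sub>R D x k) - (2 * h) *\<^sub>R g x = v"
    and \<delta>: "\<delta> > 0" "\<delta> \<le> (norm (g x))\<^sup>2"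
  shows "h\<^sup>2 - \<bar>h\<bar> * norm v / sqrt \<delta> \<le> (\<Sum>k\<in>Basis. (norm (D x k))\<^sup>2)"
proof -
  define a where "a = norm (g x)"
  define S where "S = (\<Sum>k\<in>Basis. (norm (D x k))\<^sup>2)"
  have a: "sqrt \<delta> \<le> a" "0 < a" unfolding a_def using \<delta> real_le_lsqrt[of "norm (g x)" \<delta>]
    by (auto simp: real_sqrt_le_iff intro: real_le_lsqrt)
  have "(\<Sum>k\<in>Basis. (g x \<bullet> k) *\<^sub>R D x k) = (1/2) *\<^sub>R v + h *\<^sub>R g x"
    unfolding v[symmetric] by (simp add: scaleR_sum_right scaleR_diff_right)
  then have "(norm ((1/2) *\<^sub>R v + h *\<^sub>R g x))\<^sup>2 \<le> (\<Sum>k\<in>Basis. (g x \<bullet> k)\<^sup>2) * S"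
    using norm_sum_scaleR_squared_le[of "\<lambda>k. g x \<bullet> k" "\<lambda>k. D x k" Basis] by (simp add: S_def)
  also have "(\<Sum>k\<in>Basis. (g x \<bullet> k)\<^sup>2) = a\<^sup>2"
    unfolding a_def power2_norm_eq_inner euclidean_inner[of "g x" "g x"] by (simp add: power2_eq_square)
  finally have 1: "(norm ((1/2) *\<^sub>R v + h *\<^sub>R g x))\<^sup>2 \<le> a\<^sup>2 * S" .
  have "(norm ((1/2) *\<^sub>R v + h *\<^sub>R g x))\<^sup>2 = (norm v)\<^sup>2 / 4 + h * (v \<bullet> g x) + h\<^sup>2 * a\<^sup>2"
    unfolding a_def power2_norm_eq_inner
    by (simp add: inner_add_left inner_add_right inner_commute power2_eq_square)
  moreover have "- (\<bar>h\<bar> * norm v * a) \<le> h * (v \<bullet> g x)"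
  proof -
    have "\<bar>h * (v \<bullet> g x)\<bar> \<le> \<bar>h\<bar> * (norm v * a)"
      unfolding abs_mult a_def by (intro mult_left_mono Cauchy_Schwarz_ineq2) auto
    then show ?thesis by simp
  qed
  moreover have "0 \<le> (norm v)\<^sup>2 / 4" by simp
  ultimately have "h\<^sup>2 * a\<^sup>2 - \<bar>h\<bar> * norm v * a \<le> a\<^sup>2 * S" using 1 by linarith
  moreover have "a\<^sup>2 * (h\<^sup>2 - \<bar>h\<bar> * norm v / a) = h\<^sup>2 * a\<^sup>2 - \<bar>h\<bar> * norm v * a"
    using a by (simp add: power2_eq_square right_diff_distrib)
  ultimately have "a\<^sup>2 * (h\<^sup>2 - \<bar>h\<bar> * norm v / a) \<le> a\<^sup>2 * S" by simp
  then have "h\<^sup>2 - \<bar>h\<bar> * norm v / a \<le> S" using a by simp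
  moreover have "\<bar>h\<bar> * norm v / a \<le> \<bar>h\<bar> * norm v / sqrt \<delta>"
    using a \<delta> by (intro divide_left_mono) auto
  ultimately show ?thesis by (simp add: S_def)
qed

text \<open>Only finiteness matters here: it gives \<open>Q\<close> a finite supremum, near which
  the maximum principle is applied.\<close>

lemma g_bounded: "\<exists>C. \<forall>x. norm (g x) \<le> C"
proof -
  obtain F where "\<And>x. \<bar>G1 (u x)\<bar> \<le> F" using bounded_on_range[OF G1_cont] by blast
  then show ?thesis by (intro gradient_bounded[of M F] u_bound) (simp add: Laplace)
qed

text \<open>If sup \<open>Q\<close> exceeded \<open>\<delta>\<close>, the second order condition at
  approximate maximum points would bound a fixed positive gain by errors proportional to
  \<open>\<mu>\<close>, which can be taken small.\<close>

lemma gradient_bound_approx: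
  assumes \<delta>: "\<delta> > 0"
  shows "(norm (g x))\<^sup>2 \<le> 2 * G (u x) + 2 * \<delta>"
proof -
  obtain C where C: "C > 0" "\<And>x. \<bar>G1 (u x)\<bar> \<le> C"
    using bounded_on_range[OF G1_cont] by blast
  \<comment> \<open>Where |g|^2 is at least \<open>\<delta>\<close>, the term \<open>l\<close> |g|^2
    is at least \<open>C + 1\<close> and outweighs any negative value of \<open>G1\<close> on the
    range by 1.\<close>
  define l where "l = (C + 1) / \<delta>"
  have l: "l > 0" "l * \<delta> = C + 1" using C(1) \<delta> by (auto simp: l_def)
  define E where "E = exp (l * M)"
  have E: "E > 0" by (simp add: E_def)
  \<comment> \<open>Since \<psi> is at most \<open>E\<close> on the range of \<open>u\<close>, the
    perturbation of 2 G(u) costs at most \<open>\<delta>\<close>.\<close>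
  define \<epsilon> where "\<epsilon> = \<delta> / (2 * E)"
  have \<epsilon>: "\<epsilon> > 0" "2 * \<epsilon> * E = \<delta>" using E \<delta> by (auto simp: \<epsilon>_def)
  define \<psi> where "\<psi> = (\<lambda>s. E - exp (- l * s))"
  define \<psi>1 where "\<psi>1 = (\<lambda>s. l * exp (- l * s))"
  define H where "H = (\<lambda>s. G s + \<epsilon> * \<psi> s)"
  define H1 where "H1 = (\<lambda>s. G1 s + \<epsilon> * \<psi>1 s)"
  define H2 where "H2 = (\<lambda>s. G2 s - \<epsilon> * (l * \<psi>1 s))"
  have H: "(H has_real_derivative H1 s) (at s)" for s
    unfolding H_def H1_def \<psi>_def \<psi>1_def by (rule derivative_eq_intros G_deriv | simp)+
  have H1: "(H1 has_real_derivative H2 s) (at s)" for s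
    unfolding H1_def H2_def \<psi>1_def by (rule derivative_eq_intros G1_deriv | simp)+
  have H2_cont: "continuous_on UNIV H2"
    unfolding H2_def \<psi>1_def by (intro continuous_intros G2_cont)
  have expE: "exp (- l * u x) \<le> E" "1 / E \<le> exp (- l * u x)" for x
  proof -
    have "\<bar>l * u x\<bar> \<le> l * M" unfolding abs_mult using u_bound[of x] l by (simp add: mult_left_mono)
    then have "- l * u x \<le> l * M" "- (l * M) \<le> - l * u x" by linarith+
    then show "exp (- l * u x) \<le> E" "1 / E \<le> exp (- l * u x)"
      unfolding E_def by (simp_all only: exp_le_cancel_iff exp_minus[symmetric] inverse_eq_divide[symmetric])
  qed
  have \<psi>_bounds: "0 \<le> \<psi> (u x)" "\<psi> (u x) \<le> E" for x
    using expE[of x] by (simp_all add: \<psi>_def)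
  have \<psi>1_bounds: "l / E \<le> \<psi>1 (u x)" "\<psi>1 (u x) \<le> l * E" for x
    using mult_left_mono[OF expE(1)[of x], of l] mult_left_mono[OF expE(2)[of x], of l] l by (simp_all add: \<psi>1_def)
  define Q where "Q = (\<lambda>x. (norm (g x))\<^sup>2 - 2 * H (u x))"
  have H0: "0 \<le> H (u x)" for x using G_nonneg[of "u x"] \<psi>_bounds(1)[of x] \<epsilon> by (simp add: H_def)
  have "\<exists>B. \<forall>x. Q x \<le> B"
  proof -
    obtain B where B: "\<And>x. norm (g x) \<le> B" using g_bounded by blast
    have "Q x \<le> B\<^sup>2" for x
      using power_mono[OF B[of x], of 2] H0[of x] by (simp add: Q_def)
    then show ?thesis by blast
  qed
  then have bdd: "bdd_above (range Q)" by (auto simp: bdd_above_def)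
  have "Q x \<le> \<delta>" for x
  proof (rule ccontr)
    assume "\<not> Q x \<le> \<delta>"
    then have sup: "\<delta> < (SUP x. Q x)" using cSUP_upper[OF _ bdd, of x] by simp
    define B where "B = C + \<epsilon> * (l * E)"
    define c where "c = \<epsilon> * (l / E)"
    have c: "c > 0" using \<epsilon> l E by (simp add: c_def)
    define A where "A = B * 4 / sqrt \<delta> + 2 * real DIM('a)"
    have A: "A > 0" using C \<epsilon> l E \<delta> by (auto simp: A_def B_def intro!: add_pos_nonneg divide_pos_pos)
    \<comment> \<open>\<open>c\<close> bounds the gain from below and \<open>\<mu> * A\<close> is
      the sum of both error terms. As \<open>A\<close> does not depend on \<open>\<mu>\<close>, this
      choice makes the errors equal to \<open>c / 2\<close>.\<close>
    define \<mu> where "\<mu> = c / (2 * A)"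
    have \<mu>: "\<mu> > 0" using c A by (simp add: \<mu>_def)
    have "max \<delta> ((SUP x. Q x) - 2 * \<mu>) < (SUP x. Q x)" using sup \<mu> by simp
    then obtain x1 where x1: "max \<delta> ((SUP x. Q x) - 2 * \<mu>) < Q x1"
      by (metis less_cSUP_iff[OF _ bdd] UNIV_not_empty)
    have "Q y - 2 * \<mu> < Q x1" for y
      using cSUP_upper[OF _ bdd, of y] x1 by simp
    from approximate_max_point[OF H H1 H2_cont \<mu> this[unfolded Q_def]] obtain x where
      x: "dist x1 x < 1" "Q x1 \<le> Q x" and
      v: "(\<Sum>k\<in>Basis. (2 * (g x \<bullet> k)) *\<^sub>R D x k) - (2 * H1 (u x)) *\<^sub>R g x = (4 * \<mu>) *\<^sub>R (x - x1)" and
      L: "(\<Sum>k\<in>Basis. (norm (D x k))\<^sup>2) + (G2 (u x) - H2 (u x)) * (norm (g x))\<^sup>2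
       - H1 (u x) * G1 (u x) \<le> 2 * \<mu> * real DIM('a)"
      unfolding Q_def by blast
    \<comment> \<open>\<open>H (u x)\<close> is nonnegative, so a large value of \<open>Q\<close>
      forces a large gradient, which both \<open>hessian_lower_bound\<close> and the choice of
      \<open>l\<close> require.\<close>
    have g\<delta>: "\<delta> \<le> (norm (g x))\<^sup>2" using x(2) x1 H0[of x] by (simp add: Q_def)
    define p where "p = \<psi>1 (u x)"
    have p: "l / E \<le> p" "p \<le> l * E" using \<psi>1_bounds[of x] by (auto simp: p_def)
    have p0: "0 < p" using l E by (intro less_le_trans[OF _ p(1)]) simp
    have H1B: "\<bar>H1 (u x)\<bar> \<le> B"
    proof -
      have "\<bar>\<epsilon> * p\<bar> \<le> \<epsilon> * (l * E)" using p p0 \<epsilon> by (simp add: abs_mult)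
      then show ?thesis using C(2)[of x] by (simp add: H1_def B_def p_def)
    qed
    have nv: "norm ((4 * \<mu>) *\<^sub>R (x - x1)) \<le> 4 * \<mu>"
      using x(1) \<mu> by (simp add: dist_norm norm_minus_commute)
    have "\<bar>H1 (u x)\<bar> * norm ((4 * \<mu>) *\<^sub>R (x - x1)) / sqrt \<delta> \<le> B * (4 * \<mu>) / sqrt \<delta>"
      using H1B nv \<delta> by (intro divide_right_mono mult_mono) auto
    with hessian_lower_bound[OF v \<delta> g\<delta>]
    have S: "(H1 (u x))\<^sup>2 - B * (4 * \<mu>) / sqrt \<delta> \<le> (\<Sum>k\<in>Basis. (norm (D x k))\<^sup>2)" by linarith
    \<comment> \<open>This product is what remains of the second order inequality once the Hessian
      is bounded below by \<open>(H1 (u x))\<^sup>2\<close>: the terms without \<psi> cancel and the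
      concavity of \<psi> supplies \<open>l\<close> |g|^2.\<close>
    have "\<epsilon> * p * (G1 (u x) + \<epsilon> * p + l * (norm (g x))\<^sup>2) \<ge> \<epsilon> * p * 1"
    proof (rule mult_left_mono)
      have "C + 1 \<le> l * (norm (g x))\<^sup>2" using g\<delta> l by (metis mult_left_mono less_imp_le)
      moreover have "0 \<le> \<epsilon> * p" using \<epsilon> p0 by simp
      ultimately show "1 \<le> G1 (u x) + \<epsilon> * p + l * (norm (g x))\<^sup>2" using C(2)[of x] by linarith
    qed (use \<epsilon> p0 in simp)
    moreover have "c \<le> \<epsilon> * p" unfolding c_def using p(1) \<epsilon> by (intro mult_left_mono) auto
    moreover have "(H1 (u x))\<^sup>2 + (G2 (u x) - H2 (u x)) * (norm (g x))\<^sup>2 - H1 (u x) * G1 (u x)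
       = \<epsilon> * p * (G1 (u x) + \<epsilon> * p + l * (norm (g x))\<^sup>2)"
      by (simp add: H1_def H2_def p_def power2_eq_square algebra_simps)
    ultimately have "c \<le> B * (4 * \<mu>) / sqrt \<delta> + 2 * \<mu> * real DIM('a)" using S L by linarith
    also have "\<dots> = \<mu> * A" by (simp add: A_def algebra_simps)
    also have "\<dots> = c / 2" using A by (simp add: \<mu>_def)
    finally show False using c by simp
  qed
  then have "(norm (g x))\<^sup>2 \<le> 2 * H (u x) + \<delta>" by (simp add: Q_def algebra_simps)
  moreover have "2 * (\<epsilon> * \<psi> (u x)) \<le> \<delta>"
    using \<psi>_bounds(2)[of x] \<epsilon> by (metis mult.assoc mult_left_mono less_imp_le zero_less_mult_iff zero_less_numeral)
  ultimately show ?thesis by (simp add: H_def)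
qed

theorem Modica_gradient_bound: "(norm (g x))\<^sup>2 \<le> 2 * G (u x)"
proof (rule field_le_epsilon)
  fix e :: real assume "e > 0"
  then show "(norm (g x))\<^sup>2 \<le> 2 * G (u x) + e" using gradient_bound_approx[of "e / 2" x] by simp
qed

section \<open>Positivity of the potential along a nonconstant solution\<close>

lemma G_quadratic_at_zero:
  assumes "G (u z) = 0"
  shows "\<exists>C>0. \<forall>x. G (u x) \<le> C * (u x - u z)\<^sup>2"
proof -
  have M0: "0 \<le> M" using u_bound[of z] by linarith
  have "compact (G2 ` {-M..M})"
    by (intro compact_continuous_image continuous_on_subset[OF G2_cont]) auto
  then obtain C where C: "C > 0" "\<And>s. s \<in> {-M..M} \<Longrightarrow> \<bar>G2 s\<bar> \<le> C"
    unfolding real_norm_def[symmetric] by (metis compact_imp_bounded bounded_pos imageI)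
  \<comment> \<open>A zero of the nonnegative \<open>G\<close> is a minimum, so the Taylor expansion
    there starts with the quadratic term.\<close>
  have G1z: "G1 (u z) = 0"
    using DERIV_local_min[OF G_deriv, of 1 "u z"] assms G_nonneg by auto
  have "G s \<le> C * (s - u z)\<^sup>2" if s: "s \<in> {-M..M}" for s
  proof (cases "s = u z")
    case True then show ?thesis using assms by simp
  next
    case False
    define diff where "diff = (\<lambda>n::nat. if n = 0 then G else if n = 1 then G1 else G2)"
    have "\<exists>t. (if s < u z then s < t \<and> t < u z else u z < t \<and> t < s) \<and>
        G s = (\<Sum>m<2. (diff m (u z) / fact m) * (s - u z) ^ m) + (diff 2 t / fact 2) * (s - u z) ^ 2"
    proof (rule Taylor)
      show "\<forall>m t. m < 2 \<and> - M \<le> t \<and> t \<le> M \<longrightarrow> (diff m has_real_derivative diff (Suc m) t) (at t)"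
        using G_deriv G1_deriv by (auto simp: diff_def)
    qed (use False s u_bound[of z] in \<open>auto simp: diff_def\<close>)
    then obtain t where t: "if s < u z then s < t \<and> t < u z else u z < t \<and> t < s"
      "G s = (\<Sum>m<2. (diff m (u z) / fact m) * (s - u z) ^ m) + (diff 2 t / fact 2) * (s - u z) ^ 2" by blast
    have "G s = (G2 t / 2) * (s - u z)\<^sup>2"
      using t(2) assms G1z by (simp add: diff_def numeral_2_eq_2)
    also have "\<dots> \<le> C * (s - u z)\<^sup>2"
    proof (rule mult_right_mono)
      have "t \<in> {-M..M}" using t(1) s u_bound[of z] by (auto split: if_splits)
      from C(2)[OF this] C(1) show "G2 t / 2 \<le> C" by linarith
    qed simp
    finally show ?thesis .
  qed
  moreover have "u x \<in> {-M..M}" for x using u_bound[of x] by auto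
  ultimately show ?thesis using C(1) by blast
qed

text \<open>A Gronwall argument on the segment from \<open>z\<close> to \<open>y\<close>: at a zero
  of \<open>G (u z)\<close> the gradient bound gives |w'| \<le> A |w|, so w^2 exp(- 2 A t) is
  nonincreasing. It starts at 0, so \<open>w\<close> vanishes.\<close>

lemma G_u_pos:
  assumes "\<not> u constant_on UNIV"
  shows "0 < G (u z)"
proof (rule ccontr)
  assume "\<not> 0 < G (u z)"
  then have z: "G (u z) = 0" using G_nonneg[of "u z"] by linarith
  from G_quadratic_at_zero[OF this] obtain C where C: "C > 0" "\<And>x. G (u x) \<le> C * (u x - u z)\<^sup>2" by blast
  have "u y = u z" for y
  proof -
    define h where "h = y - z"
    define A where "A = sqrt (2 * C) * norm h"
    define w where "w = (\<lambda>t. u (z + t *\<^sub>R h) - u z)"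
    define w' where "w' = (\<lambda>t. g (z + t *\<^sub>R h) \<bullet> h)"
    have w_deriv: "(w has_real_derivative w' t) (at t)" for t
      unfolding w_def w'_def
      using DERIV_diff[OF has_real_derivative_along_line[OF u_deriv] DERIV_const] by simp
    have w': "\<bar>w' t\<bar> \<le> A * \<bar>w t\<bar>" for t
    proof -
      have "(norm (g (z + t *\<^sub>R h)))\<^sup>2 \<le> 2 * C * (w t)\<^sup>2"
        using Modica_gradient_bound[of "z + t *\<^sub>R h"] C(2)[of "z + t *\<^sub>R h"] by (simp add: w_def)
      then have "norm (g (z + t *\<^sub>R h)) \<le> sqrt (2 * C) * \<bar>w t\<bar>"
        by (metis norm_ge_zero real_sqrt_abs real_sqrt_le_iff real_sqrt_mult real_sqrt_pow2 real_sqrt_abs2 power2_eq_square abs_of_nonneg)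
      then have "norm (g (z + t *\<^sub>R h)) * norm h \<le> sqrt (2 * C) * \<bar>w t\<bar> * norm h"
        by (intro mult_right_mono) auto
      then show ?thesis using Cauchy_Schwarz_ineq2[of "g (z + t *\<^sub>R h)" h]
        by (simp add: A_def w'_def mult_ac)
    qed
    define f where "f = (\<lambda>t. (w t)\<^sup>2 * exp (- (2 * A) * t))"
    define f' where "f' = (\<lambda>t. (2 * w t * w' t - 2 * A * (w t)\<^sup>2) * exp (- (2 * A) * t))"
    have "(f has_real_derivative f' t) (at t)" for t
      unfolding f_def f'_def
      by (rule derivative_eq_intros w_deriv refl)+ (simp add: algebra_simps)
    moreover have "f' t \<le> 0" for t
    proof -
      have "w t * w' t \<le> \<bar>w t\<bar> * \<bar>w' t\<bar>" by (metis abs_ge_self abs_mult)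
      also have "\<dots> \<le> \<bar>w t\<bar> * (A * \<bar>w t\<bar>)" by (intro mult_left_mono w') auto
      also have "\<dots> = A * (w t)\<^sup>2" by (simp add: power2_eq_square)
      finally show ?thesis unfolding f'_def by (intro mult_nonpos_nonneg) auto
    qed
    ultimately have "f 1 \<le> f 0"
      by (intro DERIV_nonpos_imp_nonincreasing[of 0 1 f]) auto
    then have "(w 1)\<^sup>2 * exp (- (2 * A)) \<le> 0" by (simp add: f_def w_def)
    then have "(w 1)\<^sup>2 \<le> 0" by (simp add: mult_le_0_iff)
    then show ?thesis by (simp add: w_def h_def)
  qed
  then have "u constant_on UNIV" unfolding constant_on_def by blast
  with assms show False by simp
qed

end

section \<open>Integration by parts\<close>

lemma integrable_compactly_supported:
  fixes f :: "'a::euclidean_space \<Rightarrow> real"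
  assumes "continuous_on UNIV f" "\<And>x. norm x > R \<Longrightarrow> f x = 0"
  shows "integrable lborel f"
proof -
  have "integrable lborel (\<lambda>x. indicator (cball 0 R) x *\<^sub>R f x)"
    by (intro borel_integrable_compact continuous_on_subset[OF assms(1)]) auto
  moreover have "(\<lambda>x. indicator (cball 0 R) x *\<^sub>R f x) = f"
    using assms(2) by (auto simp: indicator_def fun_eq_iff not_le)
  ultimately show ?thesis by simp
qed

text \<open>The integral of a difference quotient vanishes by translation invariance.\<close>

lemma integral_directional_derivative_eq_0:
  fixes f :: "'a::euclidean_space \<Rightarrow> real"
  assumes der: "\<And>x. (f has_derivative f' x) (at x)"
    and cont: "continuous_on UNIV (\<lambda>x. f' x k)"
    and supp: "\<And>x. norm x > R \<Longrightarrow> f x = 0"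
  shows "(LINT x|lborel. f' x k) = 0"
proof -
  define T where "T = (\<lambda>n. 1 / real (Suc n))"
  have T: "T \<longlonglongrightarrow> 0" "\<And>n. T n > 0" "\<And>n. T n \<le> 1"
    unfolding T_def by (rule LIMSEQ_Suc[OF lim_1_over_n]) simp_all
  define F where "F = (\<lambda>n x. (f (x + T n *\<^sub>R k) - f x) / T n)"
  have f_cont: "continuous_on UNIV f"
    using der by (meson continuous_at_imp_continuous_on has_derivative_continuous)
  have [measurable]: "f \<in> borel_measurable borel" "(\<lambda>x. f' x k) \<in> borel_measurable borel"
    using f_cont cont by (auto intro: borel_measurable_continuous_onI)
  have int_f: "integrable lborel f" by (rule integrable_compactly_supported[OF f_cont supp])
  have int_F: "(LINT x|lborel. F n x) = 0" for n
  proof -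
    have 1: "integrable lborel (\<lambda>x. f (T n *\<^sub>R k + x))"
      by (rule integrable_compactly_supported[of _ "R + norm (T n *\<^sub>R k)"])
         (auto intro!: supp continuous_on_compose2[OF f_cont] continuous_intros,
          smt (verit) norm_triangle_ineq norm_minus_cancel add_minus_cancel minus_add_cancel norm_scaleR)
    have "(LINT x|lborel. f (T n *\<^sub>R k + x)) = (LINT x|distr lborel borel ((+) (T n *\<^sub>R k)). f x)"
      by (subst integral_distr) auto
    then have "(LINT x|lborel. f (T n *\<^sub>R k + x)) = (LINT x|lborel. f x)"
      by (simp add: lborel_distr_plus)
    then show ?thesis using 1 int_f by (simp add: F_def add.commute)
  qed
  have mvt: "\<exists>s. 0 < s \<and> s < T n \<and> F n x = f' (x + s *\<^sub>R k) k" for n x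
  proof -
    obtain s where "0 < s" "s < T n" "f (x + T n *\<^sub>R k) - f (x + 0 *\<^sub>R k) = (T n - 0) * f' (x + s *\<^sub>R k) k"
      using MVT2[OF T(2)[of n], of "\<lambda>s. f (x + s *\<^sub>R k)" "\<lambda>s. f' (x + s *\<^sub>R k) k"]
        has_real_derivative_along_line[OF der] by auto
    then show ?thesis using T(2)[of n] by (intro exI[of _ s]) (auto simp: F_def field_simps)
  qed
  \<comment> \<open>The majorant lives on the ball of radius \<open>R + norm k\<close>, outside
    which both values in the quotient vanish. The intermediate points can lie a further
    \<open>norm k\<close> away, hence the factor 2.\<close>
  have "compact ((\<lambda>x. f' x k) ` cball 0 (R + 2 * norm k))"
    by (intro compact_continuous_image continuous_on_subset[OF cont]) auto
  then obtain B where B: "B > 0" "\<And>x. x \<in> cball 0 (R + 2 * norm k) \<Longrightarrow> \<bar>f' x k\<bar> \<le> B"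
    unfolding real_norm_def[symmetric] by (metis compact_imp_bounded bounded_pos imageI)
  have Tk: "norm (s *\<^sub>R k) \<le> norm k" if "0 \<le> s" "s \<le> T n" for s n
    using that T(3)[of n] by (simp add: mult_left_le_one_le)
  have "(\<lambda>n. LINT x|lborel. F n x) \<longlonglongrightarrow> (LINT x|lborel. f' x k)"
  proof (rule integral_dominated_convergence[where w = "\<lambda>x. B * indicator (cball 0 (R + norm k)) x"])
    show "integrable lborel (\<lambda>x. B * indicator (cball 0 (R + norm k)) x)"
      using emeasure_lborel_cball_finite[of 0 "R + norm k"] by (intro integrable_mult_right) auto
    show "AE x in lborel. (\<lambda>n. F n x) \<longlonglongrightarrow> f' x k"
    proof (rule AE_I2)
      fix x
      have "\<forall>n. \<exists>s. 0 < s \<and> s < T n \<and> F n x = f' (x + s *\<^sub>R k) k" using mvt by blast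
      then obtain s where s: "\<And>n. 0 < s n" "\<And>n. s n < T n" "\<And>n. F n x = f' (x + s n *\<^sub>R k) k"
        by metis
      have "norm (s n) \<le> T n" for n using s(1,2)[of n] by simp
      then have "s \<longlonglongrightarrow> 0" by (intro Lim_null_comparison[OF _ T(1)] always_eventually) simp
      then have "(\<lambda>n. x + s n *\<^sub>R k) \<longlonglongrightarrow> x + 0 *\<^sub>R k" by (intro tendsto_intros)
      then show "(\<lambda>n. F n x) \<longlonglongrightarrow> f' x k"
        unfolding s(3) using continuous_on_tendsto_compose[OF cont] by simp
    qed
    show "AE x in lborel. norm (F n x) \<le> B * indicator (cball 0 (R + norm k)) x" for n
    proof (rule AE_I2)
      fix x
      show "norm (F n x) \<le> B * indicator (cball 0 (R + norm k)) x"
      proof (cases "norm x \<le> R + norm k")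
        case True
        obtain s where s: "0 < s" "s < T n" "F n x = f' (x + s *\<^sub>R k) k" using mvt by blast
        have "norm (x + s *\<^sub>R k) \<le> R + 2 * norm k"
          using norm_triangle_ineq[of x "s *\<^sub>R k"] Tk[of s n] s True by simp
        then show ?thesis using B(2)[of "x + s *\<^sub>R k"] s True by simp
      next
        case False
        have "norm x \<le> norm (x + T n *\<^sub>R k) + norm (T n *\<^sub>R k)"
          using norm_triangle_ineq4[of "x + T n *\<^sub>R k" "T n *\<^sub>R k"] by simp
        then have "norm (x + T n *\<^sub>R k) > R" "norm x > R"
          using False Tk[of "T n" n] T(2)[of n] norm_ge_zero[of k] by linarith+
        then show ?thesis using supp B by (simp add: F_def)
      qed
    qed
  qed (auto simp: F_def)
  then show ?thesis unfolding int_F using LIMSEQ_unique tendsto_const by blast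
qed

text \<open>The divergence theorem without boundary term, summed over coordinates from the vanishing
  integral of each directional derivative.\<close>

theorem integral_divergence_eq_0:
  fixes Y :: "'a::euclidean_space \<Rightarrow> 'a"
  assumes der: "\<And>x. (Y has_derivative Y' x) (at x)"
    and cont: "\<And>k. continuous_on UNIV (\<lambda>x. Y' x k)"
    and supp: "\<And>x. norm x > R \<Longrightarrow> Y x = 0"
  shows "(LINT x|lborel. (\<Sum>b\<in>Basis. Y' x b \<bullet> b)) = 0"
    and "integrable lborel (\<lambda>x. \<Sum>b\<in>Basis. Y' x b \<bullet> b)"
proof -
  have Y'0: "Y' x k = 0" if x: "norm x > R" for x k
  proof -
    have "(Y has_derivative (\<lambda>h. 0)) (at x)"
    proof (rule has_derivative_transform_within_open)
      show "((\<lambda>x. 0) has_derivative (\<lambda>h. 0)) (at x)" by simp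
      show "open (- cball (0::'a) R)" by auto
    qed (use x supp in auto)
    then show ?thesis using has_derivative_unique[OF der] by metis
  qed
  have int: "integrable lborel (\<lambda>x. Y' x b \<bullet> b)" for b
    by (rule integrable_compactly_supported[of _ R]) (use Y'0 in \<open>auto intro!: continuous_intros cont\<close>)
  have "(LINT x|lborel. Y' x b \<bullet> b) = 0" for b
    by (rule integral_directional_derivative_eq_0[of "\<lambda>x. Y x \<bullet> b" "\<lambda>x h. Y' x h \<bullet> b" b R])
       (use supp in \<open>auto intro!: has_derivative_inner_left der continuous_intros cont\<close>)
  then show "(LINT x|lborel. (\<Sum>b\<in>Basis. Y' x b \<bullet> b)) = 0"
    using int by (simp add: Bochner_Integration.integral_sum)
  show "integrable lborel (\<lambda>x. \<Sum>b\<in>Basis. Y' x b \<bullet> b)"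
    using int by (rule Bochner_Integration.integrable_sum)
qed

lemma set_integrable_ball_continuous:
  fixes f :: "'a::euclidean_space \<Rightarrow> real"
  assumes "continuous_on UNIV f"
  shows "set_integrable lborel (ball 0 R) f"
proof (rule set_integrable_subset)
  show "set_integrable lborel (cball 0 R) f"
    unfolding set_integrable_def
    by (intro borel_integrable_compact continuous_on_subset[OF assms]) auto
qed auto

text \<open>Squaring the positive part makes it continuously differentiable. Both the cutoff in the
  stability inequality and the truncated Pohozaev weight rely on this.\<close>

lemma has_real_derivative_max_0_squared:
  "((\<lambda>s::real. (max 0 s)\<^sup>2) has_real_derivative 2 * max 0 s) (at s)"
proof (cases "s = 0")
  case False
  show ?thesis
  proof (cases "s > 0")
    case True
    have "((\<lambda>s. s\<^sup>2) has_real_derivative 2 * max 0 s) (at s)"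
      using True by (auto intro!: derivative_eq_intros)
    then show ?thesis
      by (rule has_field_derivative_transform_within_open[of _ _ _ "{0<..}"]) (use True in auto)
  next
    case neg: False
    have "((\<lambda>s. 0) has_real_derivative 2 * max 0 s) (at s)" using neg by auto
    then show ?thesis
      by (rule has_field_derivative_transform_within_open[of _ _ _ "{..<0}"]) (use False neg in auto)
  qed
next
  case True
  have "((\<lambda>h::real. (max 0 h)\<^sup>2 / h) \<longlongrightarrow> 0) (at 0)"
  proof (rule Lim_null_comparison)
    show "\<forall>\<^sub>F h in at 0. norm ((max 0 h)\<^sup>2 / h :: real) \<le> \<bar>h\<bar>"
      by (auto intro!: always_eventually simp: max_def power2_eq_square)
    show "((\<lambda>h::real. \<bar>h\<bar>) \<longlongrightarrow> 0) (at 0)" by (simp add: tendsto_rabs_zero)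
  qed
  then show ?thesis using True by (simp add: has_field_derivative_iff)
qed

section \<open>Stability and the Pohozaev identity\<close>

context semilinear_solution
begin

lemma G_u_deriv: "((\<lambda>x. G (u x)) has_derivative (\<lambda>h. (G1 (u x) *\<^sub>R g x) \<bullet> h)) (at x)"
  using has_derivative_compose[OF u_deriv G_deriv[THEN has_field_derivative_imp_has_derivative]]
  by simp

lemma G_u_cont: "continuous_on UNIV (\<lambda>x. G (u x))"
  using continuous_on_compose2[OF G_cont u_cont] by auto

lemma G1_u_cont: "continuous_on UNIV (\<lambda>x. G1 (u x))"
  using continuous_on_compose2[OF G1_cont u_cont] by auto

text \<open>The stability inequality with the gradient of the test function and a radius bounding
  its support as explicit data.\<close>

definition stable :: bool where
  "stable \<longleftrightarrow> (\<forall>v gv R. (\<forall>x. (v has_derivative (\<lambda>h. gv x \<bullet> h)) (at x)) \<and> continuous_on UNIV gv \<and>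
      (\<forall>x. norm x > R \<longrightarrow> v x = 0) \<longrightarrow> 0 \<le> (LINT x|lborel. (norm (gv x))\<^sup>2 + G2 (u x) * (v x)\<^sup>2))"

text \<open>Subtracting the vanishing integral of \<open>div (G'(u) \<phi>\<^sup>2 g / 2)\<close> from the second variation
  at \<open>\<surd>G(u) \<phi>\<close> leaves a multiple of the deficit \<open>2 G(u) - |g|\<^sup>2\<close>.\<close>

lemma second_variation_sqrt_G:
  fixes \<phi> :: "'a \<Rightarrow> real" and g\<phi> :: "'a \<Rightarrow> 'a"
  assumes pos: "\<And>x. 0 < G (u x)"
    and stable: stable
    and \<phi>: "\<And>x. (\<phi> has_derivative (\<lambda>h. g\<phi> x \<bullet> h)) (at x)"
    and g\<phi>_cont: "continuous_on UNIV g\<phi>"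
    and supp: "\<And>x. norm x > R \<Longrightarrow> \<phi> x = 0" "\<And>x. norm x > R \<Longrightarrow> g\<phi> x = 0"
  defines "A \<equiv> \<lambda>s. (G1 s)\<^sup>2 / (4 * G s) - G2 s / 2"
  shows "(LINT x|lborel. A (u x) * (2 * G (u x) - (norm (g x))\<^sup>2) * (\<phi> x)\<^sup>2)
      \<le> (LINT x|lborel. G (u x) * (norm (g\<phi> x))\<^sup>2)"
proof -
  have \<phi>_cont: "continuous_on UNIV \<phi>"
    using \<phi> by (meson continuous_at_imp_continuous_on has_derivative_continuous)
  \<comment> \<open>On the range of \<open>u\<close> the coefficient \<open>A\<close> is - sqrt(G)
    (sqrt G)'', the quantity controlled by the concavity hypothesis.\<close>
  define v where "v = (\<lambda>x. sqrt (G (u x)) * \<phi> x)"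
  define gv where "gv = (\<lambda>x. (G1 (u x) / (2 * sqrt (G (u x))) * \<phi> x) *\<^sub>R g x + sqrt (G (u x)) *\<^sub>R g\<phi> x)"
  have v: "(v has_derivative (\<lambda>h. gv x \<bullet> h)) (at x)" for x
  proof -
    have "((\<lambda>x. sqrt (G (u x))) has_derivative (\<lambda>h. (G1 (u x) *\<^sub>R g x) \<bullet> h * (inverse (sqrt (G (u x))) / 2))) (at x)"
      using has_derivative_compose[OF G_u_deriv
        DERIV_real_sqrt[OF pos, THEN has_field_derivative_imp_has_derivative]] by (simp add: mult_ac)
    from has_derivative_mult[OF this \<phi>] show ?thesis unfolding v_def
      by (rule has_derivative_eq_rhs)
         (auto simp: gv_def fun_eq_iff inner_add_left field_simps)
  qed
  have gv_cont: "continuous_on UNIV gv"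
    unfolding gv_def using pos
    by (intro continuous_intros G1_u_cont G_u_cont \<phi>_cont g\<phi>_cont g_cont) (auto simp: less_imp_neq[symmetric])
  have Q: "0 \<le> (LINT x|lborel. (norm (gv x))\<^sup>2 + G2 (u x) * (v x)\<^sup>2)"
    using stable[unfolded stable_def, rule_format, of v gv R] v gv_cont by (simp add: v_def supp)
  define Y where "Y = (\<lambda>x. (G1 (u x) * (\<phi> x)\<^sup>2) *\<^sub>R g x)"
  define Y' where "Y' = (\<lambda>x h. (G1 (u x) * (\<phi> x)\<^sup>2) *\<^sub>R D x h
      + (G1 (u x) * (2 * \<phi> x * (g\<phi> x \<bullet> h)) + G2 (u x) * (g x \<bullet> h) * (\<phi> x)\<^sup>2) *\<^sub>R g x)"
  have Y: "(Y has_derivative Y' x) (at x)" for x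
  proof -
    have "((\<lambda>x. (\<phi> x)\<^sup>2) has_derivative (\<lambda>h. 2 * \<phi> x * (g\<phi> x \<bullet> h))) (at x)"
      using has_derivative_power[OF \<phi>, where n = 2] by (simp add: mult_ac)
    from has_derivative_scaleR[OF has_derivative_mult[OF G1_u_deriv this] g_deriv]
    show ?thesis unfolding Y_def Y'_def by simp
  qed
  have Y'_cont: "continuous_on UNIV (\<lambda>x. Y' x k)" for k
    unfolding Y'_def by (intro continuous_intros G1_u_cont G2_u_cont \<phi>_cont g\<phi>_cont g_cont D_cont)
  have Y_supp: "Y x = 0" if "norm x > R" for x using supp that by (simp add: Y_def)
  note div = integral_divergence_eq_0[of Y Y', OF Y Y'_cont Y_supp]
  have trace: "(\<Sum>b\<in>Basis. Y' x b \<bullet> b) = G1 (u x) * G1 (u x) * (\<phi> x)\<^sup>2 + 2 * G1 (u x) * \<phi> x * (g\<phi> x \<bullet> g x)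
      + G2 (u x) * (\<phi> x)\<^sup>2 * (g x \<bullet> g x)" for x
  proof -
    have "(\<Sum>b\<in>Basis. Y' x b \<bullet> b) = (\<Sum>b\<in>Basis. (G1 (u x) * (\<phi> x)\<^sup>2) * (D x b \<bullet> b)
       + 2 * G1 (u x) * \<phi> x * ((g\<phi> x \<bullet> b) * (g x \<bullet> b)) + G2 (u x) * (\<phi> x)\<^sup>2 * ((g x \<bullet> b) * (g x \<bullet> b)))"
      by (rule sum.cong) (auto simp: Y'_def inner_add_left algebra_simps)
    also have "\<dots> = G1 (u x) * (\<phi> x)\<^sup>2 * G1 (u x) + 2 * G1 (u x) * \<phi> x * (g\<phi> x \<bullet> g x)
      + G2 (u x) * (\<phi> x)\<^sup>2 * (g x \<bullet> g x)"
      unfolding sum.distrib sum_distrib_left[symmetric] Laplace euclidean_inner[symmetric] ..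
    finally show ?thesis by (simp add: mult_ac)
  qed
  have A_cont: "continuous_on UNIV (\<lambda>x. A (u x))"
    unfolding A_def using pos
    by (intro continuous_intros G1_u_cont G_u_cont G2_u_cont) (auto simp: less_imp_neq[symmetric])
  have int1: "integrable lborel (\<lambda>x. A (u x) * (2 * G (u x) - (norm (g x))\<^sup>2) * (\<phi> x)\<^sup>2)"
    by (rule integrable_compactly_supported[of _ R])
       (auto simp: supp intro!: continuous_intros A_cont G_u_cont g_cont \<phi>_cont)
  have int2: "integrable lborel (\<lambda>x. G (u x) * (norm (g\<phi> x))\<^sup>2)"
    by (rule integrable_compactly_supported[of _ R])
       (auto simp: supp intro!: continuous_intros G_u_cont g\<phi>_cont)
  \<comment> \<open>The cross term \<open>G1 (u x) * \<phi> x * s\<close> in the squared gradient is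
    exactly half of the one in the divergence, which accounts for the factor 1/2.\<close>
  have pt: "(norm (gv x))\<^sup>2 + G2 (u x) * (v x)\<^sup>2 = G (u x) * (norm (g\<phi> x))\<^sup>2
      - A (u x) * (2 * G (u x) - (norm (g x))\<^sup>2) * (\<phi> x)\<^sup>2 + (1/2) * (\<Sum>b\<in>Basis. Y' x b \<bullet> b)" for x
  proof -
    define r where "r = sqrt (G (u x))"
    have r: "r > 0" and Gr: "G (u x) = r\<^sup>2" using pos[of x] by (auto simp: r_def)
    define p where "p = g x \<bullet> g x"
    define q where "q = g\<phi> x \<bullet> g\<phi> x"
    define s where "s = g\<phi> x \<bullet> g x"
    have "(norm (gv x))\<^sup>2 = (G1 (u x) / (2 * r) * \<phi> x)\<^sup>2 * p + 2 * (G1 (u x) / (2 * r) * \<phi> x) * r * s + r\<^sup>2 * q"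
      unfolding power2_norm_eq_inner gv_def r_def[symmetric] p_def q_def s_def
      by (simp add: inner_add_left inner_add_right inner_commute power2_eq_square algebra_simps)
    moreover have "2 * (G1 (u x) / (2 * r) * \<phi> x) * r * s = G1 (u x) * \<phi> x * s" using r by simp
    moreover have "(G1 (u x) / (2 * r) * \<phi> x)\<^sup>2 = (A (u x) + G2 (u x) / 2) * (\<phi> x)\<^sup>2"
      unfolding A_def Gr by (simp add: power_mult_distrib power_divide)
    ultimately have 1: "(norm (gv x))\<^sup>2 = (A (u x) + G2 (u x) / 2) * (\<phi> x)\<^sup>2 * p + G1 (u x) * \<phi> x * s + r\<^sup>2 * q"
      by simp
    have 2: "G1 (u x) * G1 (u x) = 4 * r\<^sup>2 * (A (u x) + G2 (u x) / 2)"
      unfolding A_def Gr using r by (simp add: power2_eq_square)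
    have 3: "(v x)\<^sup>2 = r\<^sup>2 * (\<phi> x)\<^sup>2" by (simp add: v_def r_def power_mult_distrib pos less_imp_le)
    show ?thesis
      unfolding trace power2_norm_eq_inner[of "g x"] power2_norm_eq_inner[of "g\<phi> x"]
        p_def[symmetric] q_def[symmetric] s_def[symmetric] Gr 1 2 3
      by (simp add: algebra_simps)
  qed
  show ?thesis
    using Q unfolding pt using int1 int2 div by simp
qed

text \<open>\<open>I\<close> is the divergence of \<open>F (x \<bullet> x) *\<^sub>R Z x\<close>,
  where \<open>Z\<close> is the stress-energy tensor of the equation applied to the position
  vector.\<close>

lemma Pohozaev_identity:
  fixes F F' :: "real \<Rightarrow> real"
  assumes F: "\<And>t. t \<ge> 0 \<Longrightarrow> (F has_real_derivative F' t) (at t)"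
    and F'_cont: "continuous_on {0..} F'"
    and supp: "\<And>t. t > R\<^sup>2 \<Longrightarrow> F t = 0" and R: "R \<ge> 0"
  defines "e \<equiv> \<lambda>x. (norm (g x))\<^sup>2 / 2 + G (u x)"
  defines "I \<equiv> \<lambda>x. 2 * F' (x \<bullet> x) * ((x \<bullet> g x)\<^sup>2 - (x \<bullet> x) * e x)
      + F (x \<bullet> x) * ((norm (g x))\<^sup>2 - real DIM('a) * e x)"
  shows "(LINT x|lborel. I x) = 0" "integrable lborel I"
proof -
  have F_cont: "continuous_on {0..} F"
    using F by (intro continuous_at_imp_continuous_on) (auto intro: DERIV_continuous)
  have Fx_cont: "continuous_on UNIV (\<lambda>x::'a. F (x \<bullet> x))"
    by (rule continuous_on_compose2[OF F_cont]) (auto intro!: continuous_intros)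
  have F'x_cont: "continuous_on UNIV (\<lambda>x::'a. F' (x \<bullet> x))"
    by (rule continuous_on_compose2[OF F'_cont]) (auto intro!: continuous_intros)
  have e_eq: "e = (\<lambda>x. (g x \<bullet> g x) / 2 + G (u x))"
    by (simp add: e_def power2_norm_eq_inner)
  have e_cont: "continuous_on UNIV e"
    unfolding e_eq by (intro continuous_intros g_cont G_u_cont) auto
  define Z where "Z = (\<lambda>x. (x \<bullet> g x) *\<^sub>R g x - e x *\<^sub>R x)"
  define Z' where "Z' = (\<lambda>x h. (x \<bullet> g x) *\<^sub>R D x h + (x \<bullet> D x h + h \<bullet> g x) *\<^sub>R g x
      - (e x *\<^sub>R h + (g x \<bullet> D x h + G1 (u x) * (g x \<bullet> h)) *\<^sub>R x))"
  have e_deriv: "(e has_derivative (\<lambda>h. g x \<bullet> D x h + G1 (u x) * (g x \<bullet> h))) (at x)" for x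
  proof -
    have "((\<lambda>x. (g x \<bullet> g x) / 2) has_derivative (\<lambda>h. g x \<bullet> D x h)) (at x)"
      by (rule has_derivative_eq_rhs[OF bounded_linear.has_derivative[OF bounded_linear_divide
        has_derivative_inner[OF g_deriv g_deriv]]]) (auto simp: inner_commute)
    from has_derivative_add[OF this G_u_deriv] show ?thesis unfolding e_eq by simp
  qed
  have Z: "(Z has_derivative Z' x) (at x)" for x
    unfolding Z_def
    by (rule has_derivative_eq_rhs[OF has_derivative_diff[OF
        has_derivative_scaleR[OF has_derivative_inner[OF has_derivative_ident g_deriv] g_deriv]
        has_derivative_scaleR[OF e_deriv has_derivative_ident]]]) (auto simp: Z'_def)
  have Fx_deriv: "((\<lambda>x. F (x \<bullet> x)) has_derivative (\<lambda>h. 2 * F' (x \<bullet> x) * (x \<bullet> h))) (at x)" for x :: 'a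
    by (rule has_derivative_eq_rhs[OF has_derivative_compose[OF has_derivative_inner[OF has_derivative_ident has_derivative_ident]
        F[OF inner_ge_zero, THEN has_field_derivative_imp_has_derivative]]])
       (auto simp: inner_commute fun_eq_iff)
  define Y where "Y = (\<lambda>x. F (x \<bullet> x) *\<^sub>R Z x)"
  define Y' where "Y' = (\<lambda>x h. F (x \<bullet> x) *\<^sub>R Z' x h + (2 * F' (x \<bullet> x) * (x \<bullet> h)) *\<^sub>R Z x)"
  have Y: "(Y has_derivative Y' x) (at x)" for x
    unfolding Y_def Y'_def by (rule has_derivative_scaleR[OF Fx_deriv Z])
  have Y'_cont: "continuous_on UNIV (\<lambda>x. Y' x k)" for k
    unfolding Y'_def Z_def Z'_def
    by (intro continuous_intros Fx_cont F'x_cont g_cont D_cont e_cont G1_u_cont)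
  have Y_supp: "Y x = 0" if "norm x > R" for x
  proof -
    have "x \<bullet> x > R\<^sup>2" using that R
      by (metis power2_norm_eq_inner power_strict_mono zero_less_numeral)
    then show ?thesis using supp by (simp add: Y_def)
  qed
  have trace: "(\<Sum>b\<in>Basis. Y' x b \<bullet> b) = I x" for x
  proof -
    \<comment> \<open>Symmetry of the Hessian enters here; with it the second derivatives in the
      divergence of \<open>Z\<close> cancel, except the Laplacian, which the equation cancels
      against the derivative of G(u).\<close>
    have sD: "(\<Sum>b\<in>Basis. (a \<bullet> D x b) * (c \<bullet> b)) = a \<bullet> D x c" for a c
    proof -
      have "(\<Sum>b\<in>Basis. (a \<bullet> D x b) * (c \<bullet> b)) = (\<Sum>b\<in>Basis. (D x a \<bullet> b) * (c \<bullet> b))"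
        using D_symmetric[of x _ a] by (simp add: inner_commute)
      also have "\<dots> = D x a \<bullet> c" by (rule euclidean_inner[symmetric])
      finally show ?thesis using D_symmetric[of x a c] by (simp add: inner_commute)
    qed
    have "(\<Sum>b\<in>Basis. Z' x b \<bullet> b) = (\<Sum>b\<in>Basis. (x \<bullet> g x) * (D x b \<bullet> b) + (x \<bullet> D x b) * (g x \<bullet> b)
        + (g x \<bullet> b) * (g x \<bullet> b) - (e x * (b \<bullet> b) + ((g x \<bullet> D x b) * (x \<bullet> b) + G1 (u x) * ((g x \<bullet> b) * (x \<bullet> b)))))"
      by (rule sum.cong) (auto simp: Z'_def inner_add_left inner_diff_left algebra_simps inner_commute)
    also have "\<dots> = (x \<bullet> g x) * G1 (u x) + x \<bullet> D x (g x) + g x \<bullet> g x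
        - (e x * real DIM('a) + (g x \<bullet> D x x + G1 (u x) * (g x \<bullet> x)))"
      unfolding sum_subtractf sum.distrib sum_distrib_left[symmetric] Laplace sD euclidean_inner[symmetric] by simp
    also have "x \<bullet> D x (g x) = g x \<bullet> D x x" using D_symmetric[of x "g x" x] by (simp add: inner_commute)
    finally have Z't: "(\<Sum>b\<in>Basis. Z' x b \<bullet> b) = (norm (g x))\<^sup>2 - real DIM('a) * e x"
      by (simp add: inner_commute power2_norm_eq_inner)
    have "(\<Sum>b\<in>Basis. Y' x b \<bullet> b) = (\<Sum>b\<in>Basis. F (x \<bullet> x) * (Z' x b \<bullet> b) + 2 * F' (x \<bullet> x) * ((x \<bullet> b) * (Z x \<bullet> b)))"
      by (rule sum.cong) (auto simp: Y'_def inner_add_left algebra_simps)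
    also have "\<dots> = F (x \<bullet> x) * ((norm (g x))\<^sup>2 - real DIM('a) * e x) + 2 * F' (x \<bullet> x) * (x \<bullet> Z x)"
      unfolding sum.distrib sum_distrib_left[symmetric] Z't euclidean_inner[symmetric] ..
    also have "x \<bullet> Z x = (x \<bullet> g x)\<^sup>2 - (x \<bullet> x) * e x"
      by (simp add: Z_def inner_diff_right power2_eq_square)
    finally show ?thesis by (simp add: I_def)
  qed
  show "(LINT x|lborel. I x) = 0" "integrable lborel I"
    using integral_divergence_eq_0[of Y Y', OF Y Y'_cont Y_supp] unfolding trace by auto
qed

section \<open>Lower bounds for the potential energy in balls\<close>

lemma integral_ball_G_pos:
  assumes pos: "\<And>x. 0 < G (u x)" and R: "R > 0"
  shows "0 < (LINT x:ball 0 R|lborel. G (u x))"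
proof -
  have "\<exists>z\<in>cball 0 R. \<forall>y\<in>cball 0 R. G (u z) \<le> G (u y)"
    using R by (intro continuous_attains_inf continuous_on_subset[OF G_u_cont]) auto
  then obtain z where z: "\<And>y. y \<in> cball 0 R \<Longrightarrow> G (u z) \<le> G (u y)" by blast
  have "0 < G (u z) * measure lborel (ball (0::'a) R)" using pos R by (simp add: content_ball)
  also have "\<dots> = (LINT x:ball (0::'a) R|lborel. G (u z))"
    using emeasure_lborel_ball_finite[of "0::'a" R] by (simp add: set_lebesgue_integral_def)
  also have "\<dots> \<le> (LINT x:ball 0 R|lborel. G (u x))"
    by (intro set_integral_mono set_integrable_ball_continuous G_u_cont continuous_intros z) auto
  finally show ?thesis .
qed

text \<open>Pohozaev's identity with weight \<open>F(|x|\<^sup>2)\<close>, where \<open>F = (a - A)\<^sub>+\<^sup>2 / a\<close> truncates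
  \<open>a(t) = (1 + t)\<^sup>-\<^sup>m\<close>, \<open>2m = N - 1\<close>, at its value \<open>A\<close> for \<open>t = R\<^sup>2\<close>.  The weight \<open>a\<close> is a bounded
  substitute for \<open>|x|\<^sup>1\<^sup>-\<^sup>N\<close>, which would give the monotonicity formula.\<close>

lemma weighted_energy_bound:
  assumes R: "R \<ge> 0" and dim: "DIM('a) \<ge> 2"
  defines "m \<equiv> (real DIM('a) - 1) / 2"
  defines "A \<equiv> (1 + R\<^sup>2) powr (- m)"
  defines "e \<equiv> \<lambda>x. (norm (g x))\<^sup>2 / 2 + G (u x)"
  defines "q \<equiv> \<lambda>t. max 0 ((1 + t) powr (- m) - A)"
  shows "(LINT x|lborel. e x * q (x \<bullet> x) / (1 + x \<bullet> x)) \<le> 2 * A * (LINT x:ball 0 R|lborel. e x)"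
    and "integrable lborel (\<lambda>x. e x * q (x \<bullet> x) / (1 + x \<bullet> x))"
proof -
  have m: "m > 0" using dim by (simp add: m_def)
  have "1 + R\<^sup>2 > 0" by (simp add: add_pos_nonneg)
  then have A: "A > 0" by (simp add: A_def)
  define a where "a = (\<lambda>t::real. (1 + t) powr (- m))"
  have a: "a t > 0" if "t \<ge> 0" for t using that by (simp add: a_def)
  have a_mono: "a s \<le> a t" if "0 \<le> t" "t \<le> s" for s t
    unfolding a_def using that m by (intro powr_mono2') auto
  have q_eq: "q t = max 0 (a t - A)" for t by (simp add: q_def a_def)
  have q0: "q t = 0" if "t \<ge> R\<^sup>2" for t
    using a_mono[of "R\<^sup>2" t] that by (simp add: q_eq A_def a_def)
  have q_bounds: "0 \<le> q t" "q t \<le> a t" if "t \<ge> 0" for t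
    using A a[OF that] by (auto simp: q_eq)
  \<comment> \<open>The square makes the truncated weight continuously differentiable where
    \<open>q\<close> reaches 0. The division by \<open>a\<close> keeps the truncation error below a
    multiple of \<open>A\<close>.\<close>
  define F where "F = (\<lambda>t. (q t)\<^sup>2 / a t)"
  define F' where "F' = (\<lambda>t. - (m / (1 + t)) * (2 * q t - (q t)\<^sup>2 / a t))"
  have a_deriv: "(a has_real_derivative - (m / (1 + t)) * a t) (at t)" if "t \<ge> 0" for t
  proof -
    have "(a has_real_derivative - m * (1 + t) powr (- m - 1)) (at t)"
      unfolding a_def using that by (auto intro!: derivative_eq_intros)
    then show ?thesis using that by (simp add: a_def powr_diff)
  qed
  have F: "(F has_real_derivative F' t) (at t)" if t: "t \<ge> 0" for t
  proof -
    have "((\<lambda>t. a t - A) has_real_derivative - (m / (1 + t)) * a t) (at t)"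
      using DERIV_diff[OF a_deriv[OF t] DERIV_const] by simp
    from DERIV_chain2[OF has_real_derivative_max_0_squared this]
    have "((\<lambda>t. (q t)\<^sup>2) has_real_derivative 2 * q t * (- (m / (1 + t)) * a t)) (at t)"
      by (simp add: q_eq)
    have nz: "a t \<noteq> 0" using a[OF t] by simp
    define k where "k = m / (1 + t)"
    from DERIV_divide[OF \<open>((\<lambda>t. (q t)\<^sup>2) has_real_derivative _) (at t)\<close> a_deriv[OF t] nz] show ?thesis
      unfolding F_def F'_def k_def[symmetric]
      by (rule DERIV_cong) (use nz in \<open>simp add: power2_eq_square field_simps\<close>)
  qed
  have a_cont: "continuous_on {0..} a"
    using a_deriv by (intro continuous_at_imp_continuous_on) (auto intro: DERIV_continuous)
  have q_cont: "continuous_on {0..} q"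
    unfolding q_eq by (intro continuous_intros a_cont)
  have F'_cont: "continuous_on {0..} F'"
    unfolding F'_def using a by (intro continuous_intros a_cont q_cont) (auto simp: less_imp_neq[symmetric])
  define I where "I = (\<lambda>x. 2 * F' (x \<bullet> x) * ((x \<bullet> g x)\<^sup>2 - (x \<bullet> x) * e x)
      + F (x \<bullet> x) * ((norm (g x))\<^sup>2 - real DIM('a) * e x))"
  have "F t = 0" if "t > R\<^sup>2" for t using q0[of t] that by (simp add: F_def)
  from Pohozaev_identity[OF F F'_cont this R]
  have I: "(LINT x|lborel. I x) = 0" "integrable lborel I"
    unfolding I_def e_def by auto
  have e_cont: "continuous_on UNIV e"
    unfolding e_def by (intro continuous_intros g_cont G_u_cont) auto
  have int_e: "integrable lborel (\<lambda>x. indicator (ball 0 R) x *\<^sub>R e x)"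
    using set_integrable_ball_continuous[OF e_cont] by (simp add: set_integrable_def)
  have qx_cont: "continuous_on UNIV (\<lambda>x::'a. q (x \<bullet> x))"
    by (rule continuous_on_compose2[OF q_cont]) (auto intro!: continuous_intros)
  have norm_sq: "R\<^sup>2 \<le> x \<bullet> x" if "norm x \<ge> R" for x :: 'a
    using that R by (metis power2_norm_eq_inner power_mono)
  have pos1: "1 + x \<bullet> x > 0" for x :: 'a by (simp add: add_pos_nonneg)
  define W where "W = (\<lambda>x. e x * q (x \<bullet> x) / (1 + x \<bullet> x))"
  have int_W: "integrable lborel W"
  proof (rule integrable_compactly_supported[of _ R])
    show "continuous_on UNIV W"
      unfolding W_def using pos1 by (intro continuous_intros e_cont qx_cont) (auto simp: less_imp_neq[symmetric])
    show "W x = 0" if "norm x > R" for x using q0[OF norm_sq[of x]] that by (simp add: W_def)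
  qed
  then show "integrable lborel (\<lambda>x. e x * q (x \<bullet> x) / (1 + x \<bullet> x))" by (simp add: W_def)
  \<comment> \<open>The term with \<open>(x \<bullet> g x)\<^sup>2\<close> is dropped because
    \<open>F'\<close> is nonpositive, and Modica's bound gives |g|^2 \<le> e. With N - 1 = 2 m what
    remains is 2 m e (t J / (1 + t) - F).\<close>
  have I_le: "I x \<le> 2 * m * (2 * A * (indicator (ball 0 R) x *\<^sub>R e x) - W x)" for x
  proof (cases "norm x < R")
    case False
    then have "q (x \<bullet> x) = 0" using q0[OF norm_sq[of x]] by simp
    then show ?thesis using False by (simp add: I_def W_def F'_def F_def)
  next
    case True
    define t where "t = x \<bullet> x"
    have t: "t \<ge> 0" by (simp add: t_def)
    define J where "J = 2 * q t - (q t)\<^sup>2 / a t"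
    have q2: "(q t)\<^sup>2 / a t \<le> q t"
      using q_bounds[OF t] a[OF t] by (simp add: power2_eq_square divide_le_eq mult_left_mono)
    have J: "q t \<le> J" using q2 by (simp add: J_def)
    have e0: "0 \<le> e x" using G_nonneg[of "u x"] by (simp add: e_def)
    have N: "real DIM('a) = 2 * m + 1" by (simp add: m_def field_simps)
    have ge: "(norm (g x))\<^sup>2 \<le> e x" using Modica_gradient_bound[of x] by (simp add: e_def)
    have F'J: "F' t = - (m / (1 + t)) * J" by (simp add: F'_def J_def)
    have F'0: "F' t \<le> 0"
      unfolding F'J using J q_bounds(1)[OF t] t m by (simp add: mult_nonneg_nonneg)
    have F0: "0 \<le> F t" using a[OF t] by (simp add: F_def)
    have "2 * F' t * (x \<bullet> g x)\<^sup>2 \<le> 0" using F'0 by (simp add: mult_nonpos_nonneg)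
    moreover have "F t * ((norm (g x))\<^sup>2 - real DIM('a) * e x) \<le> F t * (e x - real DIM('a) * e x)"
      using ge F0 by (intro mult_left_mono) auto
    ultimately have "I x \<le> - 2 * F' t * t * e x + F t * (e x - real DIM('a) * e x)"
      by (simp add: I_def t_def[symmetric] right_diff_distrib)
    also have "\<dots> = 2 * m * e x * (t / (1 + t) * J - F t)"
      unfolding F'J N by (simp add: algebra_simps)
    also have "t / (1 + t) * J = J - J / (1 + t)" using t by (simp add: field_simps)
    also have "2 * m * e x * (J - J / (1 + t) - F t) \<le> 2 * m * e x * (2 * A - q t / (1 + t))"
    proof (rule mult_left_mono)
      \<comment> \<open>The difference is 2 q (a - q) / a, and a - q equals \<open>A\<close>
        wherever \<open>q\<close> is nonzero.\<close>
      have "J - F t \<le> 2 * A"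
      proof (cases "q t = 0")
        case True then show ?thesis using A by (simp add: J_def F_def)
      next
        case False
        then have qa: "q t = a t - A" by (auto simp: q_eq max_def split: if_splits)
        have "J - F t = 2 * (q t * (a t - q t) / a t)"
          using a[OF t] by (simp add: J_def F_def power2_eq_square field_simps)
        also have "q t * (a t - q t) / a t = (q t / a t) * A" using qa by simp
        also have "(q t / a t) * A \<le> 1 * A"
          using q_bounds[OF t] a[OF t] A by (intro mult_right_mono) auto
        finally show ?thesis by simp
      qed
      moreover have "q t / (1 + t) \<le> J / (1 + t)" using J t by (intro divide_right_mono) auto
      ultimately show "J - J / (1 + t) - F t \<le> 2 * A - q t / (1 + t)" by linarith
    qed (use m e0 in simp)
    also have "\<dots> = 2 * m * (2 * A * (indicator (ball 0 R) x *\<^sub>R e x) - W x)"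
      using True by (simp add: W_def t_def algebra_simps)
    finally show ?thesis .
  qed
  have "0 \<le> (LINT x|lborel. 2 * m * (2 * A * (indicator (ball 0 R) x *\<^sub>R e x) - W x))"
    unfolding I(1)[symmetric] using int_e int_W I(2) I_le
    by (intro integral_mono integrable_mult_right Bochner_Integration.integrable_diff) auto
  also have "\<dots> = 2 * m * (2 * A * (LINT x:ball 0 R|lborel. e x) - (LINT x|lborel. W x))"
    unfolding set_lebesgue_integral_def using int_e int_W by simp
  finally show "(LINT x|lborel. e x * q (x \<bullet> x) / (1 + x \<bullet> x)) \<le> 2 * A * (LINT x:ball 0 R|lborel. e x)"
    using m by (simp add: W_def zero_le_mult_iff)
qed

text \<open>In the weighted bound the left side stays above a positive constant, contributed by the
  unit ball, while the factor \<open>A\<close> on the right is of order R^(1 - N).\<close>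

theorem energy_growth:
  assumes pos: "\<And>x. 0 < G (u x)"
  shows "\<exists>c>0. \<forall>\<^sub>F R in at_top. c * R ^ (DIM('a) - 1) \<le> (LINT x:ball 0 R|lborel. G (u x))"
proof (cases "DIM('a) \<ge> 2")
  \<comment> \<open>In dimension one the claim is only a positive lower bound, which follows from
    monotonicity in the radius.\<close>
  case False
  then have dim: "DIM('a) - 1 = 0" by simp
  have "(LINT x:ball 0 1|lborel. G (u x)) \<le> (LINT x:ball 0 R|lborel. G (u x))" if "R \<ge> 1" for R
    unfolding set_lebesgue_integral_def using that G_nonneg
    by (intro integral_mono set_integrable_ball_continuous[OF G_u_cont, unfolded set_integrable_def])
      (auto simp: indicator_def)
  then show ?thesis
    using integral_ball_G_pos[OF pos, of 1] unfolding dim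
    by (intro exI[of _ "LINT x:ball 0 1|lborel. G (u x)"]) (auto intro: eventually_at_top_linorderI)
next
  case True
  define m where "m = (real DIM('a) - 1) / 2"
  have m: "m > 0" using True by (simp add: m_def)
  \<comment> \<open>\<open>c\<close> is the untruncated weight at |x| = 1, hence its minimum on the
    unit ball. Once \<open>A\<close> is below \<open>c / 2\<close>, the truncated weight is at least
    \<open>c / 2\<close> there.\<close>
  define c where "c = 2 powr (- m)"
  have c: "c > 0" by (simp add: c_def)
  define e where "e = (\<lambda>x. (norm (g x))\<^sup>2 / 2 + G (u x))"
  have e_cont: "continuous_on UNIV e"
    unfolding e_def by (intro continuous_intros g_cont G_u_cont) auto
  have eG: "G (u x) \<le> e x" "e x \<le> 2 * G (u x)" for x
    using Modica_gradient_bound[of x] by (auto simp: e_def)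
  have e0: "0 \<le> e x" for x using G_nonneg[of "u x"] eG(1)[of x] by linarith
  define E where "E = (LINT x:ball 0 1|lborel. e x)"
  have "(LINT x:ball 0 1|lborel. G (u x)) \<le> E"
    unfolding E_def by (intro set_integral_mono set_integrable_ball_continuous G_u_cont e_cont eG)
  then have E: "E > 0" using integral_ball_G_pos[OF pos, of 1] by simp
  have "((\<lambda>R. (1 + R\<^sup>2) powr (- m)) \<longlongrightarrow> 0) at_top"
  proof (rule tendsto_neg_powr)
    show "filterlim (\<lambda>R::real. 1 + R\<^sup>2) at_top at_top"
      by (intro filterlim_tendsto_add_at_top[OF tendsto_const] filterlim_pow_at_top filterlim_ident) auto
  qed (use m in simp)
  then have "\<forall>\<^sub>F R in at_top. (1 + R\<^sup>2) powr (- m) < c / 2"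
    using c by (intro order_tendstoD(2)[where a = "c / 2"]) auto
  moreover have "\<forall>\<^sub>F R in at_top. R \<ge> (1::real)" by (rule eventually_ge_at_top)
  ultimately have "\<forall>\<^sub>F R in at_top. c * E / 16 * R ^ (DIM('a) - 1) \<le> (LINT x:ball 0 R|lborel. G (u x))"
  proof eventually_elim
    case (elim R)
    define A where "A = (1 + R\<^sup>2) powr (- m)"
    have "1 + R\<^sup>2 > 0" by (simp add: add_pos_nonneg)
    then have A: "A > 0" by (simp add: A_def)
    define W where "W = (\<lambda>x::'a. e x * max 0 ((1 + x \<bullet> x) powr (- m) - A) / (1 + x \<bullet> x))"
    have bound: "(LINT x|lborel. W x) \<le> 2 * A * (LINT x:ball 0 R|lborel. e x)" "integrable lborel W"
      unfolding W_def A_def e_def m_def using weighted_energy_bound[OF _ True, of R] elim(2) by auto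
    have int_e1: "integrable lborel (\<lambda>x. indicator (ball 0 1) x *\<^sub>R e x)"
      using set_integrable_ball_continuous[OF e_cont] by (simp add: set_integrable_def)
    \<comment> \<open>One factor 1/2 comes from the truncation and the other from 1 + |x|^2 \<le> 2
      on the unit ball.\<close>
    have "c / 4 * (indicator (ball 0 1) x *\<^sub>R e x) \<le> W x" for x
    proof (cases "norm x < 1")
      case False
      then show ?thesis using e0[of x] by (auto simp: W_def intro!: divide_nonneg_nonneg mult_nonneg_nonneg)
    next
      case x: True
      then have t: "x \<bullet> x \<le> 1"
        by (metis norm_ge_zero power2_norm_eq_inner power_le_one less_imp_le)
      have "c \<le> (1 + x \<bullet> x) powr (- m)"
        unfolding c_def using t m by (intro powr_mono2') (auto simp: add_pos_nonneg)
      then have "c / 2 \<le> (1 + x \<bullet> x) powr (- m) - A" using elim(1) unfolding A_def by linarith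
      then have "c / 2 \<le> max 0 ((1 + x \<bullet> x) powr (- m) - A)" by (rule max.coboundedI2)
      then have "e x * (c / 2) \<le> e x * max 0 ((1 + x \<bullet> x) powr (- m) - A)"
        using e0 by (intro mult_left_mono)
      then have "e x * (c / 2) / 2 \<le> W x"
        unfolding W_def using e0[of x] t c
        by (intro frac_le) (auto simp: add_pos_nonneg)
      then show ?thesis using x by (simp add: mult.commute)
    qed
    then have "(LINT x|lborel. c / 4 * (indicator (ball 0 1) x *\<^sub>R e x)) \<le> (LINT x|lborel. W x)"
      using bound(2) elim(2) int_e1 by (intro integral_mono integrable_mult_right) auto
    then have "c / 4 * E \<le> 2 * A * (LINT x:ball 0 R|lborel. e x)"
      using bound(1) elim(2) by (simp add: E_def set_lebesgue_integral_def)
    also have "(LINT x:ball 0 R|lborel. e x) \<le> (LINT x:ball 0 R|lborel. 2 * G (u x))"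
      by (intro set_integral_mono set_integrable_ball_continuous e_cont continuous_intros G_u_cont eG)
    also have "\<dots> = 2 * (LINT x:ball 0 R|lborel. G (u x))" by simp
    finally have "c * E / 16 \<le> A * (LINT x:ball 0 R|lborel. G (u x))" using A by simp
    then have "(1 + R\<^sup>2) powr m * (c * E / 16) \<le> (1 + R\<^sup>2) powr m * (A * (LINT x:ball 0 R|lborel. G (u x)))"
      by (intro mult_left_mono) auto
    also have "\<dots> = (LINT x:ball 0 R|lborel. G (u x))"
      using add_pos_nonneg[of 1 "R\<^sup>2"] by (simp add: A_def powr_minus)
    finally have 1: "(1 + R\<^sup>2) powr m * (c * E / 16) \<le> (LINT x:ball 0 R|lborel. G (u x))" .
    \<comment> \<open>R^(N - 1) = (R^2)^m is at most (1 + R^2)^m, the reciprocal of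
      \<open>A\<close>.\<close>
    have "2 * m = real (DIM('a) - 1)" using True by (simp add: m_def of_nat_diff field_simps)
    then have "R ^ (DIM('a) - 1) = R powr (2 * m)"
      using elim(2) by (simp only: powr_realpow)
    also have "\<dots> = (R\<^sup>2) powr m"
      using elim(2) by (simp add: powr_powr[symmetric])
    also have "\<dots> \<le> (1 + R\<^sup>2) powr m" using m by (intro powr_mono2) auto
    finally have "R ^ (DIM('a) - 1) * (c * E / 16) \<le> (1 + R\<^sup>2) powr m * (c * E / 16)"
      using c E by (intro mult_right_mono) auto
    with 1 show ?case by (simp add: mult.commute)
  qed
  then show ?thesis using c E by (intro exI[of _ "c * E / 16"]) auto
qed

end

section \<open>Equipartition of energy\<close>

context semilinear_solution
begin

text \<open>The stability inequality is tested with a cutoff that is at least 1 on the ball of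
  radius R, vanishes outside radius 2 R and has gradient of order 1 / R.\<close>

lemma weighted_deficit_estimate:
  assumes pos: "\<And>x. 0 < G (u x)"
    and stable: stable
    and K: "K > 0" "\<And>x. K * sqrt (G (u x)) \<le> (G1 (u x))\<^sup>2 / (4 * G (u x)) - G2 (u x) / 2"
  shows "\<exists>C. \<forall>R>0. (LINT x:ball 0 R|lborel. sqrt (G (u x)) * (2 * G (u x) - (norm (g x))\<^sup>2)) \<le> C * R ^ DIM('a) / R\<^sup>2"
proof -
  obtain B where B: "B > 0" "\<And>x. \<bar>G (u x)\<bar> \<le> B" using bounded_on_range[OF G_cont] by blast
  define P where "P = (\<lambda>x. 2 * G (u x) - (norm (g x))\<^sup>2)"
  have P0: "0 \<le> P x" for x using Modica_gradient_bound[of x] by (simp add: P_def)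
  have P_cont: "continuous_on UNIV P"
    unfolding P_def by (intro continuous_intros G_u_cont g_cont)
  have sG_cont: "continuous_on UNIV (\<lambda>x. sqrt (G (u x)))" by (intro continuous_intros G_u_cont)
  define A where "A = (\<lambda>s. (G1 s)\<^sup>2 / (4 * G s) - G2 s / 2)"
  have A_cont: "continuous_on UNIV (\<lambda>x. A (u x))"
    unfolding A_def using pos
    by (intro continuous_intros G1_u_cont G_u_cont G2_u_cont) (auto simp: less_imp_neq[symmetric])
  \<comment> \<open>1024 is the square of the 32 in the gradient bound 32 / R of the cutoff; the
    power of 2 is from the volume of the ball of radius 2 R.\<close>
  define C where "C = 1024 * B * unit_ball_vol (real DIM('a)) * 2 ^ DIM('a) / K"
  have "(LINT x:ball 0 R|lborel. sqrt (G (u x)) * P x) \<le> C * R ^ DIM('a) / R\<^sup>2" if R: "R > 0" for R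
  proof -
    define \<eta> where "\<eta> = (\<lambda>x::'a. max 0 (4 - (x \<bullet> x) / R\<^sup>2))"
    define \<phi> where "\<phi> = (\<lambda>x. (\<eta> x)\<^sup>2)"
    define g\<phi> where "g\<phi> = (\<lambda>x. (- 4 * \<eta> x / R\<^sup>2) *\<^sub>R x)"
    have \<phi>: "(\<phi> has_derivative (\<lambda>h. g\<phi> x \<bullet> h)) (at x)" for x
    proof -
      have "((\<lambda>x. 4 - (x \<bullet> x) / R\<^sup>2) has_derivative (\<lambda>h. - (2 * (x \<bullet> h)) / R\<^sup>2)) (at x)"
        by (rule has_derivative_eq_rhs[OF has_derivative_diff[OF has_derivative_const
          bounded_linear.has_derivative[OF bounded_linear_divide
            has_derivative_inner[OF has_derivative_ident has_derivative_ident]]]])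
          (simp add: inner_commute)
      from has_derivative_compose[OF this has_real_derivative_max_0_squared[THEN has_field_derivative_imp_has_derivative]]
      show ?thesis unfolding \<phi>_def \<eta>_def g\<phi>_def
        by (rule has_derivative_eq_rhs) (auto simp: fun_eq_iff)
    qed
    have \<eta>_cont: "continuous_on UNIV \<eta>"
      unfolding \<eta>_def using R by (intro continuous_intros) auto
    have g\<phi>_cont: "continuous_on UNIV g\<phi>"
      unfolding g\<phi>_def using R by (intro continuous_intros \<eta>_cont) auto
    have \<phi>_cont: "continuous_on UNIV \<phi>" unfolding \<phi>_def by (intro continuous_intros \<eta>_cont)
    have \<eta>0: "\<eta> x = 0" if "norm x > 2 * R" for x
    proof -
      have "(2 * R)\<^sup>2 \<le> (norm x)\<^sup>2" using that R by (intro power_mono) auto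
      then have "4 \<le> (x \<bullet> x) / R\<^sup>2" using R by (simp add: power2_norm_eq_inner le_divide_eq power_mult_distrib)
      then show ?thesis by (simp add: \<eta>_def)
    qed
    have supp: "\<phi> x = 0" "g\<phi> x = 0" if "norm x > 2 * R" for x
      using \<eta>0[OF that] by (simp_all add: \<phi>_def g\<phi>_def)
    have \<phi>1: "1 \<le> \<phi> x" if "norm x < R" for x
    proof -
      have "(norm x)\<^sup>2 \<le> R\<^sup>2" using that by (intro power_mono) auto
      then have "(x \<bullet> x) / R\<^sup>2 \<le> 1" using R by (simp add: power2_norm_eq_inner)
      then have "1 \<le> \<eta> x" by (simp add: \<eta>_def)
      then show ?thesis by (simp add: \<phi>_def)
    qed
    have g\<phi>_bound: "(norm (g\<phi> x))\<^sup>2 \<le> 1024 / R\<^sup>2 * indicator (cball 0 (2 * R)) x" for x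
    proof (cases "norm x \<le> 2 * R")
      case True
      have \<eta>: "0 \<le> \<eta> x" "\<eta> x \<le> 4" by (auto simp: \<eta>_def)
      have "norm (g\<phi> x) = 4 * \<eta> x / R\<^sup>2 * norm x" using \<eta> by (simp add: g\<phi>_def)
      also have "\<dots> \<le> 4 * 4 / R\<^sup>2 * (2 * R)"
        using \<eta> True R by (intro mult_mono divide_right_mono mult_left_mono) auto
      also have "\<dots> = 32 / R" using R by (simp add: power2_eq_square)
      finally have "(norm (g\<phi> x))\<^sup>2 \<le> (32 / R)\<^sup>2" by (intro power_mono) auto
      then show ?thesis using True by (simp add: power_divide)
    qed (simp add: supp)
    have int1: "integrable lborel (\<lambda>x. indicator (ball 0 R) x *\<^sub>R (sqrt (G (u x)) * P x))"
      by (rule set_integrable_ball_continuous[OF continuous_on_mult[OF sG_cont P_cont],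
        unfolded set_integrable_def])
    have int2: "integrable lborel (\<lambda>x. A (u x) * P x * (\<phi> x)\<^sup>2)"
      by (rule integrable_compactly_supported[of _ "2 * R"])
         (auto simp: supp intro!: continuous_intros A_cont P_cont \<phi>_cont)
    have int3: "integrable lborel (\<lambda>x. G (u x) * (norm (g\<phi> x))\<^sup>2)"
      by (rule integrable_compactly_supported[of _ "2 * R"])
         (auto simp: supp intro!: continuous_intros G_u_cont g\<phi>_cont)
    have "K * (indicator (ball 0 R) x *\<^sub>R (sqrt (G (u x)) * P x)) \<le> A (u x) * P x * (\<phi> x)\<^sup>2" for x
    proof -
      have KA: "0 \<le> K * sqrt (G (u x))" "K * sqrt (G (u x)) \<le> A (u x)"
        using K(1) K(2)[of x] G_nonneg[of "u x"] by (auto simp: A_def)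
      show ?thesis
      proof (cases "norm x < R")
        case True
        have "(K * sqrt (G (u x))) * P x * 1 \<le> A (u x) * P x * (\<phi> x)\<^sup>2"
          using KA P0[of x] \<phi>1[OF True] by (intro mult_mono) (auto intro!: mult_nonneg_nonneg)
        then show ?thesis using True by (simp add: mult_ac)
      next
        case False
        have "0 \<le> A (u x) * P x * (\<phi> x)\<^sup>2"
          using KA P0[of x] by (intro mult_nonneg_nonneg) auto
        then show ?thesis using False by simp
      qed
    qed
    then have "(LINT x|lborel. K * (indicator (ball 0 R) x *\<^sub>R (sqrt (G (u x)) * P x)))
        \<le> (LINT x|lborel. A (u x) * P x * (\<phi> x)\<^sup>2)"
      using int1 int2 by (intro integral_mono integrable_mult_right) auto
    also have "\<dots> \<le> (LINT x|lborel. G (u x) * (norm (g\<phi> x))\<^sup>2)"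
      unfolding A_def P_def by (rule second_variation_sqrt_G[OF pos stable \<phi> g\<phi>_cont supp]) auto
    also have "\<dots> \<le> (LINT x|lborel. B * (1024 / R\<^sup>2) * indicator (cball (0::'a) (2 * R)) x)"
    proof (rule integral_mono[OF int3])
      show "integrable lborel (\<lambda>x::'a. B * (1024 / R\<^sup>2) * indicator (cball 0 (2 * R)) x)"
        using emeasure_lborel_cball_finite[of "0::'a" "2 * R"] by (intro integrable_mult_right) auto
      show "G (u x) * (norm (g\<phi> x))\<^sup>2 \<le> B * (1024 / R\<^sup>2) * indicator (cball 0 (2 * R)) x" for x
        unfolding mult.assoc using B(1) B(2)[of x] G_nonneg[of "u x"] g\<phi>_bound[of x]
        by (intro mult_mono) auto
    qed
    also have "\<dots> = B * (1024 / R\<^sup>2) * measure lborel (cball (0::'a) (2 * R))" by simp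
    also have "\<dots> = B * (1024 / R\<^sup>2) * (unit_ball_vol (real DIM('a)) * (2 * R) ^ DIM('a))"
      using R content_cball[of "2 * R" "0::'a"] by simp
    finally have "K * (LINT x:ball 0 R|lborel. sqrt (G (u x)) * P x)
        \<le> B * (1024 / R\<^sup>2) * (unit_ball_vol (real DIM('a)) * (2 * R) ^ DIM('a))"
      by (simp add: set_lebesgue_integral_def)
    also have "\<dots> = K * (C * R ^ DIM('a) / R\<^sup>2)"
      using K(1) by (simp add: C_def power_mult_distrib mult_ac)
    finally show ?thesis using mult_le_cancel_left_pos[OF K(1)] by blast
  qed
  then show ?thesis unfolding P_def by blast
qed

text \<open>The quotient equals 1 minus half the ratio of the integrated deficit \<open>P\<close> to
  the integral of G(u), so it suffices that this ratio tends to zero.\<close>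

theorem equipartition:
  assumes pos: "\<And>x. 0 < G (u x)"
    and stable: stable
    and K: "K > 0" "\<And>x. K * sqrt (G (u x)) \<le> (G1 (u x))\<^sup>2 / (4 * G (u x)) - G2 (u x) / 2"
  shows "((\<lambda>R. (LINT x:ball 0 R|lborel. 1/2 * (norm (g x))\<^sup>2)
             / (LINT x:ball 0 R|lborel. G (u x))) \<longlongrightarrow> 1) at_top"
proof -
  define n where "n = DIM('a)"
  have n: "n \<ge> 1" by (simp add: n_def Suc_leI)
  define P where "P = (\<lambda>x. 2 * G (u x) - (norm (g x))\<^sup>2)"
  have P0: "0 \<le> P x" for x using Modica_gradient_bound[of x] by (simp add: P_def)
  have P_cont: "continuous_on UNIV P"
    unfolding P_def by (intro continuous_intros G_u_cont g_cont)
  have sGP_cont: "continuous_on UNIV (\<lambda>x. sqrt (G (u x)) * P x)" by (intro continuous_intros G_u_cont P_cont)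
  obtain C where C: "\<And>R. R > 0 \<Longrightarrow> (LINT x:ball 0 R|lborel. sqrt (G (u x)) * P x) \<le> C * R ^ n / R\<^sup>2"
    using weighted_deficit_estimate[OF pos stable K] unfolding P_def n_def by blast
  obtain c where c: "c > 0"
    "\<forall>\<^sub>F R in at_top. c * R ^ (n - 1) \<le> (LINT x:ball 0 R|lborel. G (u x))"
    using energy_growth[OF pos] unfolding n_def by blast
  define V where "V = unit_ball_vol (real n)"
  \<comment> \<open>Where sqrt(G) is at most 1 / l, \<open>P\<close> \<le> 2 G gives the constant
    term; elsewhere \<open>l\<close> sqrt(G) is at least 1.\<close>
  have P_split: "P x \<le> l * (sqrt (G (u x)) * P x) + 2 / l\<^sup>2" if l: "l > 0" for l x
  proof (cases "sqrt (G (u x)) \<le> 1 / l")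
    case True
    have "P x \<le> 2 * (sqrt (G (u x)))\<^sup>2" using G_nonneg[of "u x"] by (simp add: P_def)
    also have "\<dots> \<le> 2 * (1 / l)\<^sup>2" using True G_nonneg by (intro mult_left_mono power_mono) auto
    also have "\<dots> = 2 / l\<^sup>2" by (simp add: power_divide)
    also have "\<dots> \<le> l * (sqrt (G (u x)) * P x) + 2 / l\<^sup>2" using l P0[of x] G_nonneg[of "u x"] by simp
    finally show ?thesis .
  next
    case False
    then have "1 \<le> l * sqrt (G (u x))" using l by (simp add: field_simps)
    then have "1 * P x \<le> l * sqrt (G (u x)) * P x" using P0 by (intro mult_right_mono) auto
    moreover have "0 \<le> 2 / l\<^sup>2" by simp
    ultimately show ?thesis unfolding mult.assoc mult_1 by linarith
  qed
  define D where "D = (\<lambda>R. (LINT x:ball 0 R|lborel. P x))"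
  define E where "E = (\<lambda>R. (LINT x:ball 0 R|lborel. G (u x)))"
  have D0: "0 \<le> D R" for R unfolding D_def set_lebesgue_integral_def using P0 by (intro integral_nonneg_AE) auto
  have E0: "0 < E R" if "R > 0" for R unfolding E_def by (rule integral_ball_G_pos[OF pos that])
  have D_le: "D R \<le> R powr (2/3) * (C * R ^ n / R\<^sup>2) + 2 / (R powr (2/3))\<^sup>2 * (V * R ^ n)" if R: "R > 0" for R
  proof -
    \<comment> \<open>The exponent 2/3 balances l R^(n - 2) against R^n / l^2: both become R^(n -
      4/3).\<close>
    define l where "l = R powr (2/3)"
    have l: "l > 0" using R by (simp add: l_def)
    note integ = set_integrable_ball_continuous
    have "D R \<le> (LINT x:ball 0 R|lborel. l * (sqrt (G (u x)) * P x) + 2 / l\<^sup>2)"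
      unfolding D_def by (intro set_integral_mono integ P_cont continuous_intros G_u_cont P_split[OF l])
    also have "\<dots> = l * (LINT x:ball 0 R|lborel. sqrt (G (u x)) * P x) + (LINT x:ball (0::'a) R|lborel. 2 / l\<^sup>2)"
      using integ[OF sGP_cont] integ[OF continuous_on_const] by (subst set_integral_add) auto
    also have "(LINT x:ball (0::'a) R|lborel. 2 / l\<^sup>2) = 2 / l\<^sup>2 * (V * R ^ n)"
      using emeasure_lborel_ball_finite[of "0::'a" R] R content_ball[of R "0::'a"]
      by (simp add: set_lebesgue_integral_def V_def n_def)
    finally show ?thesis using mult_left_mono[OF C[OF R], of l] l by (simp add: l_def)
  qed
  \<comment> \<open>The exponent is (n - 4/3) - (n - 1) = - 1/3.\<close>
  define err where "err = (\<lambda>R. (C + 2 * V) / c * R powr (- (1/3)))"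
  have "\<forall>\<^sub>F R in at_top. norm (D R / E R) \<le> err R"
    using c(2) eventually_gt_at_top[of 0]
  proof eventually_elim
    case (elim R)
    have Rn: "R ^ n = R * R ^ (n - 1)" using n by (cases n) auto
    have Rp: "R ^ (n - 1) > 0" using elim by simp
    have "D R / E R \<le> D R / (c * R ^ (n - 1))"
      using elim(1) D0 c(1) Rp E0[OF elim(2)] by (intro divide_left_mono mult_pos_pos) (auto simp: E_def)
    also have "\<dots> \<le> (R powr (2/3) * (C * R ^ n / R\<^sup>2) + 2 / (R powr (2/3))\<^sup>2 * (V * R ^ n)) / (c * R ^ (n - 1))"
      using D_le[OF elim(2)] c(1) Rp by (intro divide_right_mono) auto
    also have "\<dots> = err R"
    proof -
      have R: "R > 0" by (rule elim(2))
      have 1: "R powr (2/3) = R * R powr (- (1/3))"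
        using R powr_add[of R 1 "- (1/3)"] by simp
      have "R * R = (R powr (2/3))\<^sup>2 * R powr (2/3)"
        using R by (simp add: powr_power powr_add[symmetric] power2_eq_square[symmetric])
      then have 2: "R / (R powr (2/3))\<^sup>2 = R powr (- (1/3))"
        using R unfolding 1 by (simp add: field_simps)
      have "R powr (2/3) * (C * R ^ n / R\<^sup>2) = C * R powr (- (1/3)) * R ^ (n - 1)"
        unfolding 1 Rn using R by (simp add: power2_eq_square)
      moreover have "2 / (R powr (2/3))\<^sup>2 * (V * R ^ n) = 2 * V * (R / (R powr (2/3))\<^sup>2) * R ^ (n - 1)"
        unfolding Rn by simp
      ultimately have "R powr (2/3) * (C * R ^ n / R\<^sup>2) + 2 / (R powr (2/3))\<^sup>2 * (V * R ^ n)
          = (C + 2 * V) * R powr (- (1/3)) * R ^ (n - 1)"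
        unfolding 2 by (simp add: distrib_right)
      then show ?thesis using Rp by (simp add: err_def)
    qed
    finally show ?case using D0[of R] E0[OF elim(2)] by simp
  qed
  moreover have "(err \<longlongrightarrow> 0) at_top"
    unfolding err_def by (intro tendsto_mult_right_zero tendsto_neg_powr filterlim_ident) auto
  ultimately have lim: "((\<lambda>R. D R / E R) \<longlongrightarrow> 0) at_top" by (rule Lim_null_comparison)
  have "\<forall>\<^sub>F R in at_top. 1 - 1/2 * (D R / E R) = (LINT x:ball 0 R|lborel. 1/2 * (norm (g x))\<^sup>2) / E R"
    using eventually_gt_at_top[of 0]
  proof eventually_elim
    case (elim R)
    have i: "set_integrable lborel (ball 0 R) (\<lambda>x. (norm (g x))\<^sup>2)" "set_integrable lborel (ball 0 R) (\<lambda>x. G (u x))"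
      by (intro set_integrable_ball_continuous continuous_intros g_cont G_u_cont)+
    have "D R = 2 * E R - (LINT x:ball 0 R|lborel. (norm (g x))\<^sup>2)"
      unfolding D_def E_def P_def using i by (subst set_integral_diff) auto
    then show ?case using E0[OF elim] by (simp add: field_simps)
  qed
  moreover have "((\<lambda>R. 1 - 1/2 * (D R / E R)) \<longlongrightarrow> 1) at_top"
    using tendsto_diff[OF tendsto_const tendsto_mult_left[OF lim], of 1 "1/2"] by simp
  ultimately show ?thesis unfolding E_def by (rule Lim_transform_eventually[rotated])
qed

end

section \<open>Passage to the stated hypotheses\<close>

lemma deriv_deriv_sqrt:
  fixes G G1 G2 :: "real \<Rightarrow> real"
  assumes G: "\<And>t. (G has_real_derivative G1 t) (at t)"
    and G1: "(G1 has_real_derivative G2 s) (at s)"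
    and pos: "0 < G s"
  shows "sqrt (G s) * deriv (deriv (\<lambda>t. sqrt (G t))) s = G2 s / 2 - (G1 s)\<^sup>2 / (4 * G s)"
proof -
  define r where "r = sqrt (G s)"
  have r: "r > 0" "G s = r\<^sup>2" using pos by (simp_all add: r_def)
  have d1: "((\<lambda>t. sqrt (G t)) has_real_derivative G1 t / (2 * sqrt (G t))) (at t)" if "G t > 0" for t
    using DERIV_chain2[OF DERIV_real_sqrt[OF that] G]
    by (rule DERIV_cong) (simp add: field_simps)
  have "continuous_on UNIV G"
    using G by (meson DERIV_continuous continuous_at_imp_continuous_on)
  \<comment> \<open>Openness makes the formula for the first derivative valid near \<open>s\<close>,
    so that \<open>deriv\<close> of the square root can be replaced by the explicit quotient and
    differentiated again.\<close>
  then have op: "open {t. 0 < G t}"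
    by (intro open_Collect_less continuous_on_const)
  have "((\<lambda>t. 2 * sqrt (G t)) has_real_derivative 2 * (G1 s / (2 * r))) (at s)"
    unfolding r_def by (intro DERIV_cmult d1 pos)
  moreover have "2 * sqrt (G s) \<noteq> 0" using pos by simp
  ultimately have "((\<lambda>t. G1 t / (2 * sqrt (G t))) has_real_derivative
      (G2 s * (2 * sqrt (G s)) - G1 s * (2 * (G1 s / (2 * r)))) / (2 * sqrt (G s) * (2 * sqrt (G s)))) (at s)"
    by (rule DERIV_divide[OF G1])
  then have "((\<lambda>t. G1 t / (2 * sqrt (G t))) has_real_derivative
      (G2 s * (2 * r) - G1 s * (2 * (G1 s / (2 * r)))) / (2 * r * (2 * r))) (at s)"
    unfolding r_def .
  then have "(deriv (\<lambda>t. sqrt (G t)) has_real_derivative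
      (G2 s * (2 * r) - G1 s * (2 * (G1 s / (2 * r)))) / (2 * r * (2 * r))) (at s)"
    by (rule has_field_derivative_transform_within_open[OF _ op])
       (use pos DERIV_imp_deriv[OF d1] in auto)
  then have "deriv (deriv (\<lambda>t. sqrt (G t))) s = (G2 s * (2 * r) - G1 s * (2 * (G1 s / (2 * r)))) / (2 * r * (2 * r))"
    by (rule DERIV_imp_deriv)
  then show ?thesis
    unfolding r_def[symmetric] r(2) using r(1) by (simp add: power2_eq_square field_simps)
qed

theorem proposition1p5:
  fixes G :: "real \<Rightarrow> real" and u :: "real ^ 'n \<Rightarrow> real" and K :: real
  assumes "C2 G" and "\<forall>s. G s \<ge> 0"
    and "stable_solution G u"
    and "\<not> u constant_on UNIV"
    and "bounded (range u)"
    and "K > 0"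
    and "\<forall>s\<in>range u. - deriv (deriv (\<lambda>t. sqrt (G t))) s \<ge> K"
  shows "((\<lambda>R. (LINT x:ball 0 R|lborel. 1/2 * (norm (grad u x))\<^sup>2)
             / (LINT x:ball 0 R|lborel. G (u x))) \<longlongrightarrow> 1) at_top"
proof -
  have G_diff: "(G has_real_derivative deriv G s) (at s)"
    and G1_diff: "(deriv G has_real_derivative deriv (deriv G) s) (at s)" for s
    using assms(1)
    by (auto simp: C2_real_iff DERIV_deriv_iff_real_differentiable)
  have u: "C2 u" "\<And>x. laplacian u x = deriv G (u x)"
    using assms(3) by (auto simp: stable_solution_def is_solution_def)
  obtain M where M: "\<And>x. \<bar>u x\<bar> \<le> M"
    using assms(5) by (auto simp: bounded_iff)
  define D where "D = (\<lambda>x h. \<Sum>b\<in>Basis. (grad (partial_deriv b u) x \<bullet> h) *\<^sub>R b)"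
  interpret C2_function u "grad u" D
    unfolding D_def by (rule C2_imp_C2_function[OF u(1)])
  interpret semilinear_solution u "grad u" D G "deriv G" "deriv (deriv G)" M
  proof
    show "(\<Sum>b\<in>Basis. D x b \<bullet> b) = deriv G (u x)" for x
      using C2_imp_C2_function(2)[OF u(1), of x] u(2)[of x] unfolding D_def by simp
  qed (use G_diff G1_diff assms(1,2) M in \<open>auto simp: C2_real_iff\<close>)
  \<comment> \<open>Positivity makes sqrt(G) twice differentiable on the range of \<open>u\<close>,
    so the iterated \<open>deriv\<close> in the hypothesis is a genuine second derivative
    there.\<close>
  have pos: "0 < G (u x)" for x by (rule G_u_pos[OF assms(4)])
  have stable
    unfolding stable_def
  proof (intro allI impI, elim conjE)
    fix v and gv :: "real ^ 'n \<Rightarrow> real ^ 'n" and R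
    assume v: "\<forall>x. (v has_derivative (\<lambda>h. gv x \<bullet> h)) (at x)" "continuous_on UNIV gv"
      and supp: "\<forall>x. norm x > R \<longrightarrow> v x = 0"
    have "closure {x. v x \<noteq> 0} \<subseteq> cball 0 R"
      using supp by (intro closure_minimal) (auto simp: not_less[symmetric])
    then have "compactly_supported v"
      unfolding compactly_supported_def
      by (meson bounded_cball bounded_subset closed_closure compact_eq_bounded_closed)
    then have "0 \<le> second_variation G u v"
      using assms(3) C1_I(1)[OF spec[OF v(1)] v(2)] by (auto simp: stable_solution_def)
    then show "0 \<le> (LINT x|lborel. (norm (gv x))\<^sup>2 + deriv (deriv G) (u x) * (v x)\<^sup>2)"
      unfolding second_variation_def C1_I(2)[OF spec[OF v(1)] v(2)] .
  qed
  then show ?thesis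
  proof (rule equipartition[OF pos _ \<open>K > 0\<close>])
    fix x
    \<comment> \<open>Multiplication by sqrt(G(u)) turns the concavity bound into a lower bound for
      the coefficient in the stability inequality.\<close>
    have "K * sqrt (G (u x)) \<le> - deriv (deriv (\<lambda>t. sqrt (G t))) (u x) * sqrt (G (u x))"
      using assms(7) pos[of x] by (intro mult_right_mono) auto
    also have "\<dots> = (deriv G (u x))\<^sup>2 / (4 * G (u x)) - deriv (deriv G) (u x) / 2"
      using deriv_deriv_sqrt[of G "deriv G" "deriv (deriv G)", OF G_diff G1_diff pos[of x]]
      by (simp add: mult.commute)
    finally show "K * sqrt (G (u x)) \<le> (deriv G (u x))\<^sup>2 / (4 * G (u x)) - deriv (deriv G) (u x) / 2" .
  qed
qed

end
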